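(* Let $\mathfrak{s}=(s_1,\dots,s_r)\in\mathbb{N}^r$ and $\mathbf u=(u_1,\dots,u_r)\in(\bar k^\times)^r$ such that $|u_r|_\infty<q^{\frac{s_rq}{q-1}}$ and $|u_i|_\infty\le q^{\frac{s_iq}{q-1}}$ for $i=1,\dots,r-1$. Let $G=G_{\mathfrak{s},\mathbf u}$ and $\mathbf v=\mathbf v_{\mathfrak{s},\mathbf u}$. Then $\log_G$ converges $\infty$-adically at $\mathbf v$, and for each $1\le\ell\le r$ the $(d_1+\cdots+d_\ell)$-th coordinate of $\log_G(\mathbf v)$ equals $(-1)^{r-\ell}\operatorname{Li}^\star_{(s_r,s_{r-1},\dots,s_\ell)}(u_r,u_{r-1},\dots,u_\ell).$ In particular, the $(s_1+\cdots+s_r)$-th coordinate of $\log_G(\mathbf v)$ is $(-1)^{r-1}\operatorname{Li}^\star_{(s_r,\dots,s_1)}(u_r,\dots,u_1)$.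
   Context: $k=\mathbb{F}_q(\theta)$ with $|\theta|_\infty=q$, $\mathbb{C}_\infty$ the completion of an algebraic closure of $\mathbb{F}_q((1/\theta))$, $\bar k$ the algebraic closure of $k$ in $\mathbb{C}_\infty$. $\bar k[\tau]$ is the twisted polynomial ring with $\tau c=c^q\tau$. Carlitz multiple star polylogarithm: $L_0=1$, $L_i=(\theta-\theta^q)(\theta-\theta^{q^2})\cdots(\theta-\theta^{q^i})$; for $\mathfrak{t}=(t_1,\dots,t_m)\in\mathbb{N}^m$, $\operatorname{Li}^\star_{\mathfrak{t}}(z_1,\dots,z_m)=\sum_{i_1\ge i_2\ge\cdots\ge i_m\ge0}\frac{z_1^{q^{i_1}}\cdots z_m^{q^{i_m}}}{L_{i_1}^{t_1}\cdots L_{i_m}^{t_m}}$. Construction: $d_\ell=s_\ell+\cdots+s_r$, $d=d_1+\cdots+d_r$. $N\in\mathrm{Mat}_d(\bar k)$ is block diagonal with blocks $N_\ell\in\mathrm{Mat}_{d_\ell}$ having $1$'s on the superdiagonal and $0$ elsewhere. $E\in\mathrm{Mat}_d(\bar k)$ has $(\ell,m)$ block $E[\ell m]\in\mathrm{Mat}_{d_\ell\times d_m}$ equal to $0$ if $\ell>m$, and for $\ell\le m$ with a single possibly nonzero entry in row $d_\ell$, column $1$, equal to $1$ if $\ell=m$ and $(-1)^{m-\ell}\prod_{e=\ell}^{m-1}u_e$ if $\ell<m$. $G_{\mathfrak{s},\mathbf u}=(\mathbb{G}_a^d,\rho)$ is the $t$-module with $\rho_t=\theta I_d+N+E\tau$.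 $\mathbf v_{\mathfrak{s},\mathbf u}\in\bar k^d$ is the vector whose $(d_1+\cdots+d_\ell)$-th coordinate is $(-1)^{r-\ell}u_\ell u_{\ell+1}\cdots u_r$ ($1\le\ell\le r$), all other coordinates being $0$. The logarithm $\log_G=\sum_{i\ge0}P_i\tau^i$ is the formal inverse of the exponential $\exp_G$ (the unique power series $\equiv\mathbf z$ mod degree $q$ with $\rho_a\circ\exp_G=\exp_G\circ\partial\rho_a$, $\partial\rho_a$ the $\tau^0$-coefficient); $\log_G(\mathbf x)=\sum_iP_i\mathbf x^{(i)}$ with entrywise $q^i$-th powers. *)

theory Defs
  imports
    "HOL-Algebra.Algebraic_Closure_Type"
    "HOL-Computational_Algebra.Formal_Laurent_Series"
    "HOL-Analysis.Infinite_Sum"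
    "HOL-Library.Cardinality"
    "Jordan_Normal_Form.Matrix"
begin

text \<open>Fields with a non-archimedean absolute value, which is the distance to 0.\<close>

class nonarch_field = Fields.field + metric_space +
  assumes dist_eq_dist_diff_0: "dist x y = dist (x - y) 0"
    and dist_mult_0: "dist (x * y) 0 = dist x 0 * dist y 0"
    and dist_ultrametric: "dist x z \<le> max (dist x y) (dist y z)"

abbreviation absv :: "'c::nonarch_field \<Rightarrow> real" where
  "absv x \<equiv> dist x 0"

text \<open>
  The field \<open>\<F>\<^sub>q((1/\<theta>))\<close> is the type of formal Laurent series over the finite field \<open>'f\<close>,
  \<open>q = CARD('f)\<close>, in the variable \<open>1/\<theta>\<close>, so that \<open>\<theta>\<close> is \<open>fls_X_inv\<close>. A completion of its algebraic
  closure is a complete field \<open>'c\<close> with a dense embedding of \<open>'f fls alg_closure\<close> along which the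
  absolute value of \<open>'c\<close> extends the one with \<open>|\<theta>| = q\<close>.
\<close>

definition C_infinity ::
    "('f::{finite,Fields.field} fls alg_closure \<Rightarrow> 'c::{nonarch_field,complete_space}) \<Rightarrow> bool" where
  "C_infinity \<iota> \<longleftrightarrow>
     field_hom \<iota> \<and>
     (\<forall>f. f \<noteq> 0 \<longrightarrow> absv (\<iota> (to_ac f)) = real CARD('f) powi (- fls_subdegree f)) \<and>
     closure (range \<iota>) = UNIV"

context
  fixes \<iota> :: "'f::{finite,Fields.field} fls alg_closure \<Rightarrow> 'c::{nonarch_field,complete_space}"
begin

definition const :: "'f \<Rightarrow> 'c" where
  "const c = \<iota> (to_ac (fls_const c))"

definition theta :: 'c where
  "theta = \<iota> (to_ac fls_X_inv)"

definition k_field :: "'c set" where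
  "k_field = {poly (map_poly const a) theta / poly (map_poly const b) theta | a b. b \<noteq> 0}"

definition k_bar :: "'c set" where
  "k_bar = {x. \<exists>p. p \<noteq> 0 \<and> (\<forall>i. Polynomial.coeff p i \<in> k_field) \<and> poly p x = 0}"

definition L :: "nat \<Rightarrow> 'c" where
  "L i = (\<Prod>j=1..i. theta - theta ^ (CARD('f) ^ j))"

definition Li_star_indices :: "nat \<Rightarrow> nat list set" where
  "Li_star_indices m = {ns. length ns = m \<and> sorted_wrt (\<ge>) ns}"

definition Li_star_term :: "nat list \<Rightarrow> 'c list \<Rightarrow> nat list \<Rightarrow> 'c" where
  "Li_star_term ts zs ns =
     (\<Prod>j<length ts. (zs ! j) ^ (CARD('f) ^ (ns ! j)) / L (ns ! j) ^ (ts ! j))"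

definition Li_star_converges :: "nat list \<Rightarrow> 'c list \<Rightarrow> bool" where
  "Li_star_converges ts zs \<longleftrightarrow> Li_star_term ts zs summable_on Li_star_indices (length ts)"

definition Li_star :: "nat list \<Rightarrow> 'c list \<Rightarrow> 'c" where
  "Li_star ts zs = (\<Sum>\<^sub>\<infinity>ns\<in>Li_star_indices (length ts). Li_star_term ts zs ns)"

end

text \<open>
  Since \<open>exp\<close> and \<open>log\<close> of a t-module are \<open>\<F>\<^sub>q\<close>-linear, only power series in \<open>\<tau>\<close> occur.
  A function \<open>A :: nat \<Rightarrow> 'c mat\<close> whose values are \<open>d \<times> d\<close> matrices stands for the twisted power
  series \<open>\<Sum>\<^sub>i A\<^sub>i \<tau>\<^sup>i\<close>, i.e. for the map \<open>z \<mapsto> \<Sum>\<^sub>i A\<^sub>i z\<^sup>(\<^sup>i\<^sup>)\<close>. Composition of such maps is the product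
  determined by \<open>\<tau> c = c\<^sup>q \<tau>\<close>.
\<close>

definition tw_carrier :: "nat \<Rightarrow> (nat \<Rightarrow> 'c mat) set" where
  "tw_carrier d = {A. \<forall>n. A n \<in> carrier_mat d d}"

definition tw_const :: "nat \<Rightarrow> 'c::zero mat \<Rightarrow> nat \<Rightarrow> 'c mat" where
  "tw_const d M n = (if n = 0 then M else 0\<^sub>m d d)"

definition tw_mult :: "nat \<Rightarrow> nat \<Rightarrow> (nat \<Rightarrow> 'c::comm_semiring_1 mat) \<Rightarrow> (nat \<Rightarrow> 'c mat) \<Rightarrow> nat \<Rightarrow> 'c mat" where
  "tw_mult q d A B n =
     mat d d (\<lambda>ij. \<Sum>i\<le>n. (A i * map_mat (\<lambda>x. x ^ (q ^ i)) (B (n - i))) $$ ij)"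

primrec tw_power :: "nat \<Rightarrow> nat \<Rightarrow> (nat \<Rightarrow> 'c::comm_semiring_1 mat) \<Rightarrow> nat \<Rightarrow> nat \<Rightarrow> 'c mat" where
  "tw_power q d A 0 = tw_const d (1\<^sub>m d)"
| "tw_power q d A (Suc m) = tw_mult q d A (tw_power q d A m)"

context
  fixes \<iota> :: "'f::{finite,Fields.field} fls alg_closure \<Rightarrow> 'c::{nonarch_field,complete_space}"
begin

text \<open>
  Below, \<open>R\<close> is the value \<open>\<rho>\<^sub>t\<close> of a t-module of dimension \<open>d\<close>; it determines the
  \<open>\<F>\<^sub>q\<close>-algebra homomorphism \<open>\<rho>\<close> on \<open>\<F>\<^sub>q[t]\<close>.
\<close>

definition tmod_action :: "nat \<Rightarrow> (nat \<Rightarrow> 'c mat) \<Rightarrow> 'f poly \<Rightarrow> nat \<Rightarrow> 'c mat" where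
  "tmod_action d R a n =
     mat d d (\<lambda>ij. \<Sum>m\<le>Polynomial.degree a.
       const \<iota> (Polynomial.coeff a m) * tw_power CARD('f) d R m n $$ ij)"

definition is_tmod_exp :: "nat \<Rightarrow> (nat \<Rightarrow> 'c mat) \<Rightarrow> (nat \<Rightarrow> 'c mat) \<Rightarrow> bool" where
  "is_tmod_exp d R Q \<longleftrightarrow>
     Q \<in> tw_carrier d \<and> Q 0 = 1\<^sub>m d \<and>
     (\<forall>a. tw_mult CARD('f) d (tmod_action d R a) Q =
          tw_mult CARD('f) d Q (tw_const d (tmod_action d R a 0)))"

definition tmod_exp :: "nat \<Rightarrow> (nat \<Rightarrow> 'c mat) \<Rightarrow> nat \<Rightarrow> 'c mat" where
  "tmod_exp d R = (THE Q. is_tmod_exp d R Q)"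

definition tmod_log :: "nat \<Rightarrow> (nat \<Rightarrow> 'c mat) \<Rightarrow> nat \<Rightarrow> 'c mat" where
  "tmod_log d R = (THE P. P \<in> tw_carrier d \<and>
     tw_mult CARD('f) d P (tmod_exp d R) = tw_const d (1\<^sub>m d) \<and>
     tw_mult CARD('f) d (tmod_exp d R) P = tw_const d (1\<^sub>m d))"

definition tmod_log_term :: "nat \<Rightarrow> (nat \<Rightarrow> 'c mat) \<Rightarrow> 'c vec \<Rightarrow> nat \<Rightarrow> 'c vec" where
  "tmod_log_term d R x i = tmod_log d R i *\<^sub>v map_vec (\<lambda>c. c ^ (CARD('f) ^ i)) x"

definition tmod_log_converges :: "nat \<Rightarrow> (nat \<Rightarrow> 'c mat) \<Rightarrow> 'c vec \<Rightarrow> bool" where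
  "tmod_log_converges d R x \<longleftrightarrow> (\<forall>j<d. summable (\<lambda>i. tmod_log_term d R x i $ j))"

definition tmod_log_at :: "nat \<Rightarrow> (nat \<Rightarrow> 'c mat) \<Rightarrow> 'c vec \<Rightarrow> 'c vec" where
  "tmod_log_at d R x = vec d (\<lambda>j. \<Sum>i. tmod_log_term d R x i $ j)"

end

text \<open>
  The tuples \<open>s\<close> and \<open>u\<close> are functions on \<open>{1..r}\<close>. Rows, columns and coordinates are numbered from
  0 in \<open>mat\<close> and \<open>vec\<close>, so the last row of the block \<open>l\<close> is \<open>blk_end r s l - 1\<close> and the first column
  of the block \<open>m\<close> is \<open>blk_end r s (m - 1)\<close>.
\<close>

definition blk_dim :: "nat \<Rightarrow> (nat \<Rightarrow> nat) \<Rightarrow> nat \<Rightarrow> nat" where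
  "blk_dim r s l = (\<Sum>i=l..r. s i)"

definition blk_end :: "nat \<Rightarrow> (nat \<Rightarrow> nat) \<Rightarrow> nat \<Rightarrow> nat" where
  "blk_end r s l = (\<Sum>i=1..l. blk_dim r s i)"

definition G_dim :: "nat \<Rightarrow> (nat \<Rightarrow> nat) \<Rightarrow> nat" where
  "G_dim r s = blk_end r s r"

definition G_N :: "nat \<Rightarrow> (nat \<Rightarrow> nat) \<Rightarrow> 'c::zero_neq_one mat" where
  "G_N r s = diag_block_mat
     (map (\<lambda>l. mat (blk_dim r s l) (blk_dim r s l) (\<lambda>(i, j). if j = i + 1 then 1 else 0)) [1..<Suc r])"

definition G_E :: "nat \<Rightarrow> (nat \<Rightarrow> nat) \<Rightarrow> (nat \<Rightarrow> 'c::comm_ring_1) \<Rightarrow> 'c mat" where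
  "G_E r s u = mat (G_dim r s) (G_dim r s) (\<lambda>(i, j).
     \<Sum>l=1..r. \<Sum>m=l..r.
       if i + 1 = blk_end r s l \<and> j = blk_end r s (m - 1)
       then (- 1) ^ (m - l) * (\<Prod>e=l..<m. u e) else 0)"

definition G_rho_t ::
    "('f::{finite,Fields.field} fls alg_closure \<Rightarrow> 'c::{nonarch_field,complete_space}) \<Rightarrow>
     nat \<Rightarrow> (nat \<Rightarrow> nat) \<Rightarrow> (nat \<Rightarrow> 'c) \<Rightarrow> nat \<Rightarrow> 'c mat" where
  "G_rho_t \<iota> r s u n =
     (if n = 0 then theta \<iota> \<cdot>\<^sub>m 1\<^sub>m (G_dim r s) + G_N r s
      else if n = 1 then G_E r s u
      else 0\<^sub>m (G_dim r s) (G_dim r s))"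

definition G_v :: "nat \<Rightarrow> (nat \<Rightarrow> nat) \<Rightarrow> (nat \<Rightarrow> 'c::comm_ring_1) \<Rightarrow> 'c vec" where
  "G_v r s u = vec (G_dim r s) (\<lambda>i.
     \<Sum>l=1..r. if i + 1 = blk_end r s l then (- 1) ^ (r - l) * (\<Prod>e=l..r. u e) else 0)"

end

(*
  Write D_n = theta - theta^(q^n). Comparing coefficients in P rho_t = d(rho_t) P gives the recursion
  D_n P_n + N P_n = P_n N + P_(n-1) E^(n-1), a Sylvester equation which has a unique solution because N
  is nilpotent and D_n is nonzero. Conversely a solution P is the logarithm: for any exponential Q the series P Q
  commutes with d(rho_t) = theta + N, so that P Q = 1 by the uniqueness for Sylvester equations.

  Let c_(n,m) be the last column of the block m of P_n, and let w_(n,m) be the column of P_n E^(n) at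
  the start of the block m. Going through the columns of a block yields
  c_(n,m) = (D_n + N)^(-d_m) w_(n-1,m), and the shape of E yields
  w_(n,m) = c_(n,m) - u_(m-1)^(q^n) w_(n,m-1). In the last row of a block N vanishes, and the recursion
  for w_(n,m) L_n^(d_m) becomes the one of the truncated star polylogarithms. In every row |D_n| >= 1
  bounds w_(n,m) L_n^(d_m) uniformly in n, so that the terms w_(n,r) u_r^(q^n) of the logarithm series
  tend to 0.
*)

theory Submission
  imports Defs
begin

section \<open>Frobenius powers\<close>

text \<open>The weight \<open>L_n^(d_m)\<close> is chosen because \<open>L_n = L_(n-1) D_n\<close>:
  it absorbs the factor \<open>D_n^(-d_m)\<close> produced by one step of the recursion. Since
  \<open>d_m = s_m + d_(m+1)\<close>, passing to the next block leaves
  \<open>u_m^(q^n) / L_n^(s_m)\<close>, a single factor of the star polylogarithm, and the recursion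
  in n becomes summation over one more index. Exact formulas of this kind live in the last rows of
  blocks, because elsewhere \<open>N\<close> mixes a row with the one below it; convergence,
  however, is asked for in every coordinate, so estimates run alongside the identities. For i < r
  the bound on \<open>u_i\<close> allows equality, so these factors are merely bounded and all decay
  comes from \<open>u_r\<close>. Two bridges are left. Exponential and logarithm are definite
  descriptions, so existence and uniqueness precede any computation of coefficients. And the
  polylogarithm is an unordered sum over tuples, while the logarithm is a series whose n-th term
  collects the tuples with leading index n.\<close>

lemma finite_field_power_card:
  fixes x :: "'a::{finite,Fields.field}"
  shows "x ^ CARD('a) = x"
proof (cases "x = 0")
  case False
  have "x * (\<Prod>y\<in>UNIV-{0}. x * y) = x * x ^ (CARD('a) - 1) * \<Prod>(UNIV-{0})"
    by (simp add: prod.distrib mult_ac)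
  also have "x * x ^ (CARD('a) - 1) = x ^ CARD('a)"
    by (subst power_Suc[symmetric]) simp
  also have "(\<Prod>y\<in>UNIV-{0}. x * y) = (\<Prod>y\<in>UNIV-{0}. y)"
    by (rule prod.reindex_bij_witness[of _ "\<lambda>y. y / x" "\<lambda>y. x * y"]) (use False in auto)
  finally show ?thesis by simp
qed (simp add: zero_power)

text \<open>The polynomial \<open>(X + 1)\<^sup>q - X\<^sup>q - 1\<close> has degree less than \<open>q\<close> and vanishes on the whole field.\<close>

lemma of_nat_card_choose_eq_0:
  assumes "0 < k" "k < CARD('a)"
  shows "of_nat (CARD('a) choose k) = (0 :: 'a::{finite,Fields.field})"
proof -
  define q where "q = CARD('a)"
  define p :: "'a poly" where "p = (\<Sum>k\<in>{1..<q}. monom (of_nat (q choose k)) k)"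
  have q: "q > 0" by (simp add: q_def)
  have "poly p x = 0" for x
  proof -
    have "x + 1 = (x + 1) ^ q" by (simp add: q_def finite_field_power_card)
    also have "\<dots> = (\<Sum>k\<le>q. of_nat (q choose k) * x ^ k)" by (simp add: binomial_ring)
    also have "{..q} = insert 0 (insert q {1..<q})" using q by auto
    also have "(\<Sum>k\<in>\<dots>. of_nat (q choose k) * x ^ k) = 1 + x ^ q + poly p x"
      using q by (simp add: p_def poly_sum poly_monom)
    also have "x ^ q = x" by (simp add: q_def finite_field_power_card)
    finally show ?thesis by simp
  qed
  moreover have "Polynomial.degree p < q"
    unfolding p_def using q by (intro degree_sum_less) (auto intro: le_less_trans[OF degree_monom_le])
  ultimately have "p = 0"
    using card_poly_roots_bound[of p] by (auto simp: q_def)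
  moreover have "Polynomial.coeff p k = of_nat (q choose k)"
    using assms by (simp add: p_def coeff_sum q_def)
  ultimately show ?thesis by (simp add: q_def)
qed

text \<open>Isolates what the twisted power series rest on: additivity of x -> x^q makes
  \<open>tw_mult\<close> associative, and q >= 2 gives 0^(q^n) = 0.\<close>

locale frobenius =
  fixes q :: nat and ty :: "'c::Fields.field itself"
  assumes q_ge_2: "q \<ge> 2" and frobenius_add: "(x + y :: 'c) ^ q = x ^ q + y ^ q"
begin

lemma frob_add: "(x + y :: 'c) ^ (q ^ n) = x ^ (q ^ n) + y ^ (q ^ n)"
  by (induction n) (simp_all add: power_mult mult.commute[of q] frobenius_add)

lemma frob_0 [simp]: "(0::'c) ^ (q ^ n) = 0"
  using q_ge_2 by (simp add: zero_power)

lemma frob_minus: "(- x :: 'c) ^ (q ^ n) = - (x ^ (q ^ n))"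
  using frob_add[of x "- x" n] by (simp add: add_eq_0_iff)

lemma frob_sum: "(sum f A :: 'c) ^ (q ^ n) = (\<Sum>x\<in>A. f x ^ (q ^ n))"
  by (induction A rule: infinite_finite_induct) (simp_all add: frob_add)

section \<open>The ring of twisted power series\<close>

lemma tw_carrierD:
  assumes "A \<in> tw_carrier d"
  shows "A n \<in> carrier_mat d d" "dim_row (A n) = d" "dim_col (A n) = d"
  using assms by (auto simp: tw_carrier_def)

lemma tw_mult_closed [simp]: "tw_mult q d A B \<in> tw_carrier d"
  by (simp add: tw_carrier_def tw_mult_def)

lemma tw_const_closed [simp]: "M \<in> carrier_mat d d \<Longrightarrow> tw_const d M \<in> tw_carrier d"
  by (simp add: tw_carrier_def tw_const_def)

lemma tw_eqI:
  assumes "A \<in> tw_carrier d" "B \<in> tw_carrier d"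
    and "\<And>n i j. i < d \<Longrightarrow> j < d \<Longrightarrow> A n $$ (i, j) = B n $$ (i, j)"
  shows "A = B"
proof
  fix n
  show "A n = B n"
    using assms(3) tw_carrierD(2,3)[OF assms(1), of n] tw_carrierD(2,3)[OF assms(2), of n]
    by (intro eq_matI) auto
qed

lemma tw_mult_index:
  assumes "A \<in> tw_carrier d" "B \<in> tw_carrier d" "i < d" "j < d"
  shows "tw_mult q d A B n $$ (i, j) =
    (\<Sum>m\<le>n. \<Sum>k<d. A m $$ (i, k) * (B (n - m) $$ (k, j) :: 'c) ^ (q ^ m))"
proof -
  have "(A m * map_mat (\<lambda>x. x ^ (q ^ m)) (B (n - m))) $$ (i, j) =
     (\<Sum>k<d. A m $$ (i, k) * (B (n - m) $$ (k, j)) ^ (q ^ m))" for m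
    using tw_carrierD(2,3)[OF assms(1), of m] tw_carrierD(2,3)[OF assms(2), of "n - m"] assms(3,4)
    by (auto simp: scalar_prod_def lessThan_atLeast0 intro!: sum.cong)
  thus ?thesis using assms(3,4) by (simp add: tw_mult_def)
qed

text \<open>Regroups a triangular sum by the total degree i + j, as needed to compare the two
  bracketings of a triple product.\<close>

lemma sum_triangle_shear:
  fixes f :: "nat \<Rightarrow> nat \<Rightarrow> 'b::comm_monoid_add"
  shows "(\<Sum>i\<le>n. \<Sum>j\<le>n - i. f i j) = (\<Sum>i\<le>n. \<Sum>j\<le>i. f j (i - j))"
proof -
  have "(\<Sum>i\<le>n. \<Sum>j\<le>n - i. f i j) = (\<Sum>(i,j)\<in>(SIGMA i:{..n}. {..n - i}). f i j)"
    by (simp add: sum.Sigma)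
  also have "(SIGMA i:{..n}. {..n - i}) = {(i, j). i + j \<le> n}" by auto
  finally show ?thesis by (simp only: sum.triangle_reindex_eq)
qed

text \<open>Both bracketings sum \<open>A_a B_b^(a) C_c^(a+b)\<close> over a + b + c = n; on the
  right the Frobenius power has to distribute over the sums inside \<open>B C\<close>.\<close>

lemma tw_mult_assoc:
  assumes A: "A \<in> tw_carrier d" and B: "B \<in> tw_carrier d" and C: "(C :: nat \<Rightarrow> 'c mat) \<in> tw_carrier d"
  shows "tw_mult q d (tw_mult q d A B) C = tw_mult q d A (tw_mult q d B C)"
proof (rule tw_eqI)
  fix n i j assume ij: "i < d" "j < d"
  define f where "f a b = (\<Sum>k<d. \<Sum>l<d. A a $$ (i, k) * (B b $$ (k, l)) ^ (q ^ a) *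
      (C (n - (a + b)) $$ (l, j)) ^ (q ^ (a + b)))" for a b
  have "tw_mult q d (tw_mult q d A B) C n $$ (i, j) = (\<Sum>m\<le>n. \<Sum>a\<le>m. f a (m - a))"
  proof -
    have "tw_mult q d (tw_mult q d A B) C n $$ (i, j) =
      (\<Sum>m\<le>n. \<Sum>l<d. \<Sum>a\<le>m. \<Sum>k<d. A a $$ (i, k) * (B (m - a) $$ (k, l)) ^ (q ^ a) *
        (C (n - m) $$ (l, j)) ^ (q ^ m))"
      using ij A B C by (simp add: tw_mult_index sum_distrib_right mult.assoc)
    also have "\<dots> = (\<Sum>m\<le>n. \<Sum>a\<le>m. f a (m - a))"
    proof (rule sum.cong[OF refl])
      fix m assume "m \<in> {..n}"
      have "(\<Sum>l<d. \<Sum>a\<le>m. \<Sum>k<d. A a $$ (i, k) * (B (m - a) $$ (k, l)) ^ (q ^ a) *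
          (C (n - m) $$ (l, j)) ^ (q ^ m)) = 
        (\<Sum>a\<le>m. \<Sum>l<d. \<Sum>k<d. A a $$ (i, k) * (B (m - a) $$ (k, l)) ^ (q ^ a) *
          (C (n - m) $$ (l, j)) ^ (q ^ m))" by (rule sum.swap)
      also have "\<dots> = (\<Sum>a\<le>m. f a (m - a))"
        by (rule sum.cong[OF refl], subst sum.swap) (simp add: f_def)
      finally show "(\<Sum>l<d. \<Sum>a\<le>m. \<Sum>k<d. A a $$ (i, k) * (B (m - a) $$ (k, l)) ^ (q ^ a) *
          (C (n - m) $$ (l, j)) ^ (q ^ m)) = (\<Sum>a\<le>m. f a (m - a))" .
    qed
    finally show ?thesis .
  qed
  also have "\<dots> = (\<Sum>a\<le>n. \<Sum>b\<le>n - a. f a b)" by (rule sum_triangle_shear[symmetric])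
  also have "\<dots> = tw_mult q d A (tw_mult q d B C) n $$ (i, j)"
  proof -
    have "(\<Sum>b\<le>n - a. f a b) = (\<Sum>k<d. A a $$ (i, k) * tw_mult q d B C (n - a) $$ (k, j) ^ (q ^ a))" for a
    proof -
      have "(\<Sum>k<d. A a $$ (i, k) * tw_mult q d B C (n - a) $$ (k, j) ^ (q ^ a)) =
        (\<Sum>k<d. \<Sum>b\<le>n - a. \<Sum>l<d. A a $$ (i, k) * (B b $$ (k, l)) ^ (q ^ a) *
          (C (n - (a + b)) $$ (l, j)) ^ (q ^ (a + b)))"
        using ij B C
        by (simp add: tw_mult_index frob_sum sum_distrib_left power_mult_distrib mult.assoc power_add
            mult.commute[of "q ^ a"] flip: power_mult)
      also have "\<dots> = (\<Sum>b\<le>n - a. f a b)" unfolding f_def by (rule sum.swap)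
      finally show ?thesis ..
    qed
    thus ?thesis using ij A by (simp add: tw_mult_index)
  qed
  finally show "tw_mult q d (tw_mult q d A B) C n $$ (i, j) = tw_mult q d A (tw_mult q d B C) n $$ (i, j)" .
qed auto

lemma tw_mult_const_left:
  assumes "M \<in> carrier_mat d d" "B \<in> tw_carrier d"
  shows "tw_mult q d (tw_const d M) B n = M * (B n :: 'c mat)"
proof (rule eq_matI)
  fix i j assume "i < dim_row (M * B n)" "j < dim_col (M * B n)"
  hence ij: "i < d" "j < d" using assms tw_carrierD(2,3)[OF assms(2), of n] by auto
  have "tw_mult q d (tw_const d M) B n $$ (i, j) =
     (\<Sum>m\<le>n. \<Sum>k<d. tw_const d M m $$ (i, k) * (B (n - m) $$ (k, j)) ^ (q ^ m))"
    using assms ij by (simp add: tw_mult_index)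
  also have "\<dots> = (\<Sum>m\<in>{0}. \<Sum>k<d. tw_const d M m $$ (i, k) * (B (n - m) $$ (k, j)) ^ (q ^ m))"
    using ij by (intro sum.mono_neutral_right) (auto simp: tw_const_def)
  also have "\<dots> = (M * B n) $$ (i, j)"
    using ij assms tw_carrierD(2,3)[OF assms(2), of n]
    by (auto simp: tw_const_def scalar_prod_def lessThan_atLeast0)
  finally show "tw_mult q d (tw_const d M) B n $$ (i, j) = (M * B n) $$ (i, j)" .
qed (use assms tw_carrierD(2,3)[OF assms(2), of n] in \<open>auto simp: tw_mult_def\<close>)

text \<open>Here \<open>tau^n\<close> moves past \<open>M\<close> and twists its entries, which is
  how \<open>theta\<close> becomes \<open>theta^(q^n)\<close> and the differences \<open>D_n\<close>
  arise.\<close>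

lemma tw_mult_const_right:
  assumes "M \<in> carrier_mat d d" "A \<in> tw_carrier d"
  shows "tw_mult q d A (tw_const d M) n = A n * map_mat (\<lambda>x :: 'c. x ^ (q ^ n)) M"
proof (rule eq_matI)
  fix i j assume "i < dim_row (A n * map_mat (\<lambda>x. x ^ (q ^ n)) M)" "j < dim_col (A n * map_mat (\<lambda>x. x ^ (q ^ n)) M)"
  hence ij: "i < d" "j < d" using assms tw_carrierD(2,3)[OF assms(2), of n] by auto
  have "tw_mult q d A (tw_const d M) n $$ (i, j) =
     (\<Sum>m\<le>n. \<Sum>k<d. A m $$ (i, k) * (tw_const d M (n - m) $$ (k, j)) ^ (q ^ m))"
    using assms ij by (simp add: tw_mult_index)
  also have "\<dots> = (\<Sum>m\<in>{n}. \<Sum>k<d. A m $$ (i, k) * (tw_const d M (n - m) $$ (k, j)) ^ (q ^ m))"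
    using ij by (intro sum.mono_neutral_right) (auto simp: tw_const_def)
  also have "\<dots> = (A n * map_mat (\<lambda>x. x ^ (q ^ n)) M) $$ (i, j)"
    using ij assms tw_carrierD(2,3)[OF assms(2), of n]
    by (auto simp: tw_const_def scalar_prod_def lessThan_atLeast0)
  finally show "tw_mult q d A (tw_const d M) n $$ (i, j) = (A n * map_mat (\<lambda>x. x ^ (q ^ n)) M) $$ (i, j)" .
qed (use assms tw_carrierD(2,3)[OF assms(2), of n] in \<open>auto simp: tw_mult_def\<close>)

lemma map_mat_frob_one [simp]: "map_mat (\<lambda>x :: 'c. x ^ (q ^ n)) (1\<^sub>m d) = 1\<^sub>m d"
  by (rule eq_matI) auto

lemma tw_mult_one_left [simp]:
  "A \<in> tw_carrier d \<Longrightarrow> tw_mult q d (tw_const d (1\<^sub>m d)) A = (A :: nat \<Rightarrow> 'c mat)"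
  by (rule ext) (simp add: tw_mult_const_left left_mult_one_mat[OF tw_carrierD(1)])

lemma tw_mult_one_right [simp]:
  "A \<in> tw_carrier d \<Longrightarrow> tw_mult q d A (tw_const d (1\<^sub>m d)) = (A :: nat \<Rightarrow> 'c mat)"
  by (rule ext) (simp add: tw_mult_const_right right_mult_one_mat[OF tw_carrierD(1)])

lemma tw_mult_0:
  assumes "A \<in> tw_carrier d" "B \<in> tw_carrier d"
  shows "tw_mult q d A B 0 = A 0 * (B 0 :: 'c mat)"
  using tw_carrierD(2,3)[OF assms(1), of 0] tw_carrierD(2,3)[OF assms(2), of 0]
  by (intro eq_matI) (auto simp: tw_mult_index[OF assms] tw_mult_def[of _ _ A B] scalar_prod_def lessThan_atLeast0)

text \<open>Coefficient n of \<open>A B = 1\<close> solved for \<open>B_n\<close>: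
  \<open>A_0 = 1\<close> isolates it, and the other terms involve \<open>B\<close> in smaller
  degrees.\<close>

function tw_inv_entry :: "nat \<Rightarrow> (nat \<Rightarrow> 'c mat) \<Rightarrow> nat \<Rightarrow> nat \<Rightarrow> nat \<Rightarrow> 'c" where
  "tw_inv_entry d A n i j = (if n = 0 then of_bool (i = j) else
     - (\<Sum>m\<in>{1..n}. \<Sum>k<d. A m $$ (i, k) * tw_inv_entry d A (n - m) k j ^ (q ^ m)))"
  by pat_completeness auto
termination by (relation "measure (\<lambda>(d, A, n, i, j). n)") auto

declare tw_inv_entry.simps [simp del]

lemma tw_mult_right_inverse_exists:
  assumes A: "A \<in> tw_carrier d" and A0: "A 0 = (1\<^sub>m d :: 'c mat)"
  shows "\<exists>B\<in>tw_carrier d. B 0 = 1\<^sub>m d \<and> tw_mult q d A B = tw_const d (1\<^sub>m d)"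
proof -
  define B where "B n = mat d d (\<lambda>(i, j). tw_inv_entry d A n i j)" for n
  have B: "B \<in> tw_carrier d" by (simp add: B_def tw_carrier_def)
  have B0: "B 0 = 1\<^sub>m d" by (intro eq_matI) (auto simp: B_def tw_inv_entry.simps)
  have "tw_mult q d A B = tw_const d (1\<^sub>m d)"
  proof (rule tw_eqI)
    fix n i j assume ij: "i < d" "j < d"
    show "tw_mult q d A B n $$ (i, j) = tw_const d (1\<^sub>m d) n $$ (i, j)"
    proof (cases "n = 0")
      case True
      thus ?thesis using A B A0 B0 by (simp add: tw_mult_0 tw_const_def)
    next
      case False
      have "{..n} = insert 0 {1..n}" by auto
      hence "tw_mult q d A B n $$ (i, j) = (\<Sum>k<d. (if i = k then 1 else 0) * B n $$ (k, j)) +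
          (\<Sum>m\<in>{1..n}. \<Sum>k<d. A m $$ (i, k) * B (n - m) $$ (k, j) ^ (q ^ m))"
        using ij A B by (simp add: tw_mult_index A0 one_mat_def)
      also have "(\<Sum>k<d. (if i = k then 1 else 0) * B n $$ (k, j)) = B n $$ (i, j)"
        using ij by (simp add: if_distrib[of "\<lambda>x. x * _"] cong: if_cong)
      also have "\<dots> = - (\<Sum>m\<in>{1..n}. \<Sum>k<d. A m $$ (i, k) * B (n - m) $$ (k, j) ^ (q ^ m))"
        using ij False by (simp add: B_def tw_inv_entry.simps[of d A n])
      finally show ?thesis using ij False by (simp add: tw_const_def)
    qed
  qed (use A B in auto)
  with B B0 show ?thesis by blast
qed

text \<open>The right inverse \<open>B\<close> again has constant term 1, hence a right inverse
  \<open>C\<close>, and associativity forces \<open>C = A\<close>.\<close>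

lemma tw_mult_inverse_exists:
  assumes A: "A \<in> tw_carrier d" and A0: "A 0 = (1\<^sub>m d :: 'c mat)"
  obtains B where "B \<in> tw_carrier d" "B 0 = 1\<^sub>m d"
    "tw_mult q d A B = tw_const d (1\<^sub>m d)" "tw_mult q d B A = tw_const d (1\<^sub>m d)"
proof -
  obtain B where B: "B \<in> tw_carrier d" "B 0 = 1\<^sub>m d" "tw_mult q d A B = tw_const d (1\<^sub>m d)"
    using tw_mult_right_inverse_exists[OF A A0] by blast
  obtain C where C: "C \<in> tw_carrier d" "tw_mult q d B C = tw_const d (1\<^sub>m d)"
    using tw_mult_right_inverse_exists[OF B(1,2)] by blast
  have "A = tw_mult q d A (tw_mult q d B C)" using A C by simp
  also have "\<dots> = C" by (simp only: tw_mult_assoc[symmetric, OF A B(1) C(1)] B(3) tw_mult_one_left[OF C(1)])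
  finally show ?thesis using that[of B] B C by simp
qed

end

section \<open>Sylvester equations with strictly upper triangular matrix\<close>

context
  fixes d :: nat and D :: "'c::Fields.field" and N C :: "nat \<Rightarrow> nat \<Rightarrow> 'c"
begin

text \<open>The equation \<open>D Y + N Y = Y N + C\<close> read at (i, j) and solved for the entry
  of \<open>Y\<close>. For strictly upper triangular \<open>N\<close> it refers only to entries
  further left in row i and further down in column j, so \<open>(d - i) + j\<close>
  decreases.\<close>

function sylvester_entry :: "nat \<Rightarrow> nat \<Rightarrow> 'c" where
  "sylvester_entry i j =
    (C i j + (\<Sum>k<j. sylvester_entry i k * N k j) - (\<Sum>k\<in>{i<..<d}. N i k * sylvester_entry k j)) / D"
  by pat_completeness auto
termination by (relation "measure (\<lambda>(i, j). (d - i) + j)") auto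

end

declare sylvester_entry.simps [simp del]

lemma strict_upper_mult_index:
  assumes N: "N \<in> carrier_mat d d" "\<And>i j. i < d \<Longrightarrow> j \<le> i \<Longrightarrow> N $$ (i, j) = 0"
    and Y: "Y \<in> carrier_mat d d" and ij: "i < d" "j < d"
  shows "(N * Y) $$ (i, j) = (\<Sum>k\<in>{i<..<d}. N $$ (i, k) * Y $$ (k, j))"
    and "(Y * N) $$ (i, j) = (\<Sum>k<j. Y $$ (i, k) * N $$ (k, j))"
proof -
  have "(N * Y) $$ (i, j) = (\<Sum>k<d. N $$ (i, k) * Y $$ (k, j))"
    using N Y ij by (auto simp: scalar_prod_def lessThan_atLeast0)
  also have "\<dots> = (\<Sum>k\<in>{i<..<d}. N $$ (i, k) * Y $$ (k, j))"
    using ij N(2) by (intro sum.mono_neutral_right) auto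
  finally show "(N * Y) $$ (i, j) = (\<Sum>k\<in>{i<..<d}. N $$ (i, k) * Y $$ (k, j))" .
  have "(Y * N) $$ (i, j) = (\<Sum>k<d. Y $$ (i, k) * N $$ (k, j))"
    using N Y ij by (auto simp: scalar_prod_def lessThan_atLeast0)
  also have "\<dots> = (\<Sum>k<j. Y $$ (i, k) * N $$ (k, j))"
    using ij N(2) by (intro sum.mono_neutral_right) auto
  finally show "(Y * N) $$ (i, j) = (\<Sum>k<j. Y $$ (i, k) * N $$ (k, j))" .
qed

lemma sylvester_exists:
  fixes D :: "'c::Fields.field"
  assumes N: "N \<in> carrier_mat d d" "\<And>i j. i < d \<Longrightarrow> j \<le> i \<Longrightarrow> N $$ (i, j) = 0"
    and C: "C \<in> carrier_mat d d" and D: "D \<noteq> 0"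
  shows "\<exists>Y\<in>carrier_mat d d. D \<cdot>\<^sub>m Y + N * Y = Y * N + C"
proof
  let ?f = "sylvester_entry d D (\<lambda>i j. N $$ (i, j)) (\<lambda>i j. C $$ (i, j))"
  define Y where "Y = mat d d (\<lambda>(i, j). ?f i j)"
  show Y: "Y \<in> carrier_mat d d" by (simp add: Y_def)
  show "D \<cdot>\<^sub>m Y + N * Y = Y * N + C"
  proof (rule eq_matI)
    fix i j assume "i < dim_row (Y * N + C)" "j < dim_col (Y * N + C)"
    hence ij: "i < d" "j < d" using C by auto
    have "D * Y $$ (i, j) = C $$ (i, j) + (\<Sum>k<j. Y $$ (i, k) * N $$ (k, j)) -
        (\<Sum>k\<in>{i<..<d}. N $$ (i, k) * Y $$ (k, j))"
      using ij D by (simp add: Y_def sylvester_entry.simps[of _ _ _ _ i j])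
    thus "(D \<cdot>\<^sub>m Y + N * Y) $$ (i, j) = (Y * N + C) $$ (i, j)"
      using ij N Y C by (simp add: strict_upper_mult_index[OF N Y] del: index_mult_mat(1))
  qed (use N Y C in auto)
qed

lemma sylvester_eq_0:
  fixes D :: "'c::Fields.field"
  assumes N: "N \<in> carrier_mat d d" "\<And>i j. i < d \<Longrightarrow> j \<le> i \<Longrightarrow> N $$ (i, j) = 0"
    and Y: "Y \<in> carrier_mat d d" and D: "D \<noteq> 0" and eq: "D \<cdot>\<^sub>m Y + N * Y = Y * N"
  shows "Y = 0\<^sub>m d d"
proof -
  have "Y $$ (i, j) = 0" if "i < d" "j < d" for i j
    using that
  proof (induction "(d - i) + j" arbitrary: i j rule: less_induct)
    case less
    have "(D \<cdot>\<^sub>m Y + N * Y) $$ (i, j) = (Y * N) $$ (i, j)" by (simp only: eq)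
    hence "D * Y $$ (i, j) + (\<Sum>k\<in>{i<..<d}. N $$ (i, k) * Y $$ (k, j)) = (\<Sum>k<j. Y $$ (i, k) * N $$ (k, j))"
      using less.prems N Y by (simp add: strict_upper_mult_index[OF N Y] del: index_mult_mat(1))
    moreover have "(\<Sum>k\<in>{i<..<d}. N $$ (i, k) * Y $$ (k, j)) = 0"
      using less.prems by (intro sum.neutral) (auto intro!: less.hyps)
    moreover have "(\<Sum>k<j. Y $$ (i, k) * N $$ (k, j)) = 0"
      using less.prems by (intro sum.neutral) (auto intro!: less.hyps)
    ultimately show ?case using D by simp
  qed
  thus ?thesis using Y by (intro eq_matI) auto
qed

section \<open>Non-archimedean absolute values\<close>

lemma absv_1 [simp]: "absv (1 :: 'c::nonarch_field) = 1"
  using dist_mult_0[of "1::'c" 1] by simp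

lemma absv_minus [simp]: "absv (- x) = absv (x :: 'c::nonarch_field)"
proof -
  have "absv (- 1 :: 'c) * absv (- 1 :: 'c) = 1"
    using dist_mult_0[of "- 1 :: 'c" "- 1"] by simp
  hence "absv (- 1 :: 'c) ^ 2 = 1 ^ 2" by (simp add: power2_eq_square)
  hence "absv (- 1 :: 'c) = 1" by (rule power2_eq_imp_eq) auto
  thus ?thesis using dist_mult_0[of "- 1" x] by simp
qed

lemma absv_add_le: "absv (x + y :: 'c::nonarch_field) \<le> max (absv x) (absv y)"
  using dist_ultrametric[of x "- y" 0] dist_eq_dist_diff_0[of x "- y"]
    absv_minus[of y] by (simp add: dist_commute)

lemma absv_diff_le: "absv (x - y :: 'c::nonarch_field) \<le> max (absv x) (absv y)"
  using absv_add_le[of x "- y"] by simp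

lemma absv_power: "absv (x ^ n :: 'c::nonarch_field) = absv x ^ n"
  by (induction n) (simp_all add: dist_mult_0)

lemma absv_divide: "absv (x / y :: 'c::nonarch_field) = absv x / absv y"
proof (cases "y = 0")
  case False
  thus ?thesis using dist_mult_0[of "x / y" y] by (simp add: field_simps)
qed simp

lemma absv_prod: "absv (prod f A :: 'c::nonarch_field) = (\<Prod>x\<in>A. absv (f x))"
  by (induction A rule: infinite_finite_induct) (simp_all add: dist_mult_0)

lemma absv_sum_le:
  assumes "\<And>x. x \<in> A \<Longrightarrow> absv (f x :: 'c::nonarch_field) \<le> B" "B \<ge> 0"
  shows "absv (sum f A) \<le> B"
  using assms by (induction A rule: infinite_finite_induct) (auto intro: order_trans[OF absv_add_le])

text \<open>The ultrametric inequality is sharp when the absolute values differ; this determines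
  \<open>absv\<close> of \<open>theta - theta^(q^n)\<close> exactly.\<close>

lemma absv_diff_eq:
  assumes "absv x < absv (y :: 'c::nonarch_field)"
  shows "absv (x - y) = absv y"
  using absv_diff_le[of x y] absv_add_le[of x "y - x"] absv_minus[of "x - y"] assms by simp

section \<open>Exponential and logarithm of a t-module\<close>

locale C_infinity_field =
  fixes \<iota> :: "'f::{finite,Fields.field} fls alg_closure \<Rightarrow> 'c::{nonarch_field,complete_space}"
  assumes C_inf: "C_infinity \<iota>"
begin

sublocale hom: field_hom \<iota>
  using C_inf by (simp add: C_infinity_def)

lemma const_add: "const \<iota> (x + y) = const \<iota> x + const \<iota> y"
  by (simp add: const_def hom.hom_add flip: fls_plus_const)

lemma const_power: "const \<iota> (x ^ n) = const \<iota> x ^ n"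
  by (simp add: const_def fls_const_power hom.hom_power)

lemma const_0 [simp]: "const \<iota> 0 = 0" and const_1 [simp]: "const \<iota> 1 = 1"
  by (simp_all add: const_def)

lemma const_of_nat: "const \<iota> (of_nat n) = of_nat n"
  by (induction n) (simp_all add: const_add)

text \<open>Coefficients of polynomials in t pass every \<open>tau^n\<close> unchanged, the source
  of the \<open>F_q\<close>-linearity of the action.\<close>

lemma const_frob [simp]: "const \<iota> c ^ (CARD('f) ^ n) = const \<iota> c"
proof (induction n)
  case (Suc n)
  have "const \<iota> c ^ (CARD('f) ^ Suc n) = (const \<iota> c ^ CARD('f)) ^ (CARD('f) ^ n)"
    by (simp flip: power_mult)
  also have "const \<iota> c ^ CARD('f) = const \<iota> c"
    by (simp add: finite_field_power_card flip: const_power)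
  finally show ?case using Suc by simp
qed simp

lemma card_ge_2: "CARD('f) \<ge> 2"
  using card_mono[of "UNIV :: 'f set" "{0, 1}"] by simp

sublocale frobenius "CARD('f)" "TYPE('c)"
proof
  show "CARD('f) \<ge> 2" by (rule card_ge_2)
  fix x y :: 'c
  have "(x + y) ^ CARD('f) = (\<Sum>k\<le>CARD('f). of_nat (CARD('f) choose k) * x ^ k * y ^ (CARD('f) - k))"
    by (rule binomial_ring)
  also have "\<dots> = (\<Sum>k\<in>{0, CARD('f)}. of_nat (CARD('f) choose k) * x ^ k * y ^ (CARD('f) - k))"
  proof (intro sum.mono_neutral_right ballI)
    fix k assume "k \<in> {..CARD('f)} - {0, CARD('f)}"
    \<comment> \<open>The characteristic is visible in the finite field; \<open>const\<close>
      carries the vanishing over to \<open>'c\<close>.\<close>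
    hence "of_nat (CARD('f) choose k) = (0 :: 'f)" by (intro of_nat_card_choose_eq_0) auto
    hence "of_nat (CARD('f) choose k) = (0 :: 'c)" using const_of_nat[of "CARD('f) choose k"] by simp
    thus "of_nat (CARD('f) choose k) * x ^ k * y ^ (CARD('f) - k) = 0" by simp
  qed auto
  also have "\<dots> = x ^ CARD('f) + y ^ CARD('f)" by simp
  finally show "(x + y) ^ CARD('f) = x ^ CARD('f) + y ^ CARD('f)" .
qed

lemma absv_theta: "absv (theta \<iota>) = CARD('f)"
proof -
  have "absv (theta \<iota>) = real CARD('f) powi (- fls_subdegree (fls_X_inv :: 'f fls))"
    using C_inf unfolding C_infinity_def theta_def by (simp del: fls_X_inv_subdegree)
  thus ?thesis by simp
qed

lemma absv_theta_diff: "n \<ge> 1 \<Longrightarrow> absv (theta \<iota> - theta \<iota> ^ (CARD('f) ^ n)) = real CARD('f) ^ (CARD('f) ^ n)"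
proof -
  assume n: "n \<ge> 1"
  have "(1::nat) < CARD('f) ^ n" using card_ge_2 n by (intro one_less_power) auto
  hence "real CARD('f) ^ 1 < real CARD('f) ^ (CARD('f) ^ n)" using card_ge_2 by (intro power_strict_increasing) auto
  thus ?thesis by (subst absv_diff_eq) (simp_all add: absv_power absv_theta)
qed

lemma theta_diff_nonzero: "n \<ge> 1 \<Longrightarrow> theta \<iota> - theta \<iota> ^ (CARD('f) ^ n) \<noteq> 0"
  using absv_theta_diff[of n] card_ge_2 by force

lemma tw_mult_const_right_index:
  assumes "M \<in> carrier_mat d d" "A \<in> tw_carrier d" "i < d" "j < d"
  shows "tw_mult CARD('f) d A (tw_const d M) n $$ (i, j) = (\<Sum>k<d. A n $$ (i, k) * (M $$ (k, j) :: 'c) ^ (CARD('f) ^ n))"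
  using assms tw_carrierD[OF assms(2), of n]
  by (auto simp: tw_mult_const_right scalar_prod_def lessThan_atLeast0)

lemma tw_const_mult:
  assumes "M \<in> carrier_mat d d" "M' \<in> carrier_mat d d"
  shows "tw_mult CARD('f) d (tw_const d M) (tw_const d M') = tw_const d (M * M' :: 'c mat)"
  by (rule ext) (use assms in \<open>auto simp: tw_mult_const_left tw_const_def[of _ M'] tw_const_def[of _ "M * M'"]\<close>)

lemma tw_power_closed [simp]: "tw_power CARD('f) d R m \<in> tw_carrier d"
  by (cases m) auto

lemma tmod_action_closed [simp]: "tmod_action \<iota> d R a \<in> tw_carrier d"
  by (simp add: tw_carrier_def tmod_action_def)

lemma tmod_action_X: "R \<in> tw_carrier d \<Longrightarrow> tmod_action \<iota> d R [:0, 1:] = R"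
  by (rule tw_eqI[of _ d]) (auto simp: tmod_action_def)

text \<open>Works because the constant term of a product is the product of the constant terms, so
  \<open>Q\<close> can be moved across one factor \<open>R\<close> at a time.\<close>

lemma tw_power_intertwine:
  assumes R: "(R :: nat \<Rightarrow> 'c mat) \<in> tw_carrier d" and Q: "Q \<in> tw_carrier d"
    and eq: "tw_mult CARD('f) d R Q = tw_mult CARD('f) d Q (tw_const d (R 0))"
  shows "tw_mult CARD('f) d (tw_power CARD('f) d R m) Q = tw_mult CARD('f) d Q (tw_const d (tw_power CARD('f) d R m 0))"
proof (induction m)
  case 0
  thus ?case using Q by (simp add: tw_const_def[of _ _ 0])
next
  case (Suc m)
  let ?R = "tw_power CARD('f) d R m"
  have c: "R 0 \<in> carrier_mat d d" "?R 0 \<in> carrier_mat d d"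
    using R by (simp_all add: tw_carrierD(1))
  have "tw_mult CARD('f) d (tw_mult CARD('f) d R ?R) Q = tw_mult CARD('f) d R (tw_mult CARD('f) d Q (tw_const d (?R 0)))"
    using R Q by (simp add: tw_mult_assoc Suc)
  also have "\<dots> = tw_mult CARD('f) d (tw_mult CARD('f) d R Q) (tw_const d (?R 0))"
    using R Q c by (simp add: tw_mult_assoc)
  also have "\<dots> = tw_mult CARD('f) d Q (tw_mult CARD('f) d (tw_const d (R 0)) (tw_const d (?R 0)))"
    using R Q c by (simp add: eq tw_mult_assoc)
  also have "\<dots> = tw_mult CARD('f) d Q (tw_const d (tw_mult CARD('f) d R ?R 0))"
    using R c by (simp add: tw_const_mult tw_mult_0)
  finally show ?case by simp
qed

lemma tmod_action_intertwine:
  assumes R: "R \<in> tw_carrier d" and Q: "Q \<in> tw_carrier d"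
    and eq: "tw_mult CARD('f) d R Q = tw_mult CARD('f) d Q (tw_const d (R 0))"
  shows "tw_mult CARD('f) d (tmod_action \<iota> d R a) Q = tw_mult CARD('f) d Q (tw_const d (tmod_action \<iota> d R a 0))"
proof (rule tw_eqI)
  fix n i j assume ij: "i < d" "j < d"
  let ?R = "\<lambda>e. tw_power CARD('f) d R e"
  let ?c = "\<lambda>e. const \<iota> (Polynomial.coeff a e)"
  have [simp]: "?R e 0 \<in> carrier_mat d d" for e by (simp add: tw_carrierD(1))
  have "tw_mult CARD('f) d (tmod_action \<iota> d R a) Q n $$ (i, j) =
      (\<Sum>m\<le>n. \<Sum>k<d. \<Sum>e\<le>Polynomial.degree a. ?c e * (?R e m $$ (i, k) * Q (n - m) $$ (k, j) ^ (CARD('f) ^ m)))"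
    using ij Q by (subst tw_mult_index) (simp_all add: tmod_action_def sum_distrib_right mult.assoc)
  also have "\<dots> = (\<Sum>m\<le>n. \<Sum>e\<le>Polynomial.degree a. \<Sum>k<d. ?c e * (?R e m $$ (i, k) * Q (n - m) $$ (k, j) ^ (CARD('f) ^ m)))"
    by (intro sum.cong[OF refl] sum.swap)
  also have "\<dots> = (\<Sum>e\<le>Polynomial.degree a. \<Sum>m\<le>n. \<Sum>k<d. ?c e * (?R e m $$ (i, k) * Q (n - m) $$ (k, j) ^ (CARD('f) ^ m)))"
    by (rule sum.swap)
  also have "\<dots> = (\<Sum>e\<le>Polynomial.degree a. ?c e * tw_mult CARD('f) d (?R e) Q n $$ (i, j))"
    using ij Q by (simp add: tw_mult_index sum_distrib_left)
  also have "\<dots> = (\<Sum>e\<le>Polynomial.degree a. ?c e * (\<Sum>k<d. Q n $$ (i, k) * (?R e 0 $$ (k, j)) ^ (CARD('f) ^ n)))"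
    using ij Q by (simp add: tw_power_intertwine[OF R Q eq] tw_mult_const_right_index)
  also have "\<dots> = (\<Sum>k<d. \<Sum>e\<le>Polynomial.degree a. Q n $$ (i, k) * (?c e * (?R e 0 $$ (k, j)) ^ (CARD('f) ^ n)))"
    by (subst sum.swap) (simp add: sum_distrib_left mult_ac)
  also have "\<dots> = tw_mult CARD('f) d Q (tw_const d (tmod_action \<iota> d R a 0)) n $$ (i, j)"
    using ij Q
    by (simp add: tw_mult_const_right_index tw_carrierD(1)[OF tmod_action_closed])
      (simp add: tmod_action_def frob_sum sum_distrib_left power_mult_distrib)
  finally show "tw_mult CARD('f) d (tmod_action \<iota> d R a) Q n $$ (i, j) =
    tw_mult CARD('f) d Q (tw_const d (tmod_action \<iota> d R a 0)) n $$ (i, j)" .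
qed auto

text \<open>Reduces the condition for all polynomials to the one for t: \<open>a = [:0, 1:]\<close>
  gives one direction, powers and \<open>F_q\<close>-linearity the other.\<close>

lemma is_tmod_exp_iff:
  assumes "R \<in> tw_carrier d"
  shows "is_tmod_exp \<iota> d R Q \<longleftrightarrow> Q \<in> tw_carrier d \<and> Q 0 = 1\<^sub>m d \<and>
    tw_mult CARD('f) d R Q = tw_mult CARD('f) d Q (tw_const d (R 0))"
  using tmod_action_intertwine[OF assms, of Q] tmod_action_X[OF assms]
  unfolding is_tmod_exp_def by metis

text \<open>Entries 0 and 1 are fixed by the Frobenius, so only \<open>theta\<close> is
  twisted.\<close>

lemma theta_block_frob:
  assumes N: "N \<in> carrier_mat d d" "\<And>i j. i < d \<Longrightarrow> j < d \<Longrightarrow> N $$ (i, j) \<in> {0, 1}"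
  shows "map_mat (\<lambda>x. x ^ (CARD('f) ^ n)) (theta \<iota> \<cdot>\<^sub>m 1\<^sub>m d + N) = theta \<iota> ^ (CARD('f) ^ n) \<cdot>\<^sub>m 1\<^sub>m d + N"
proof (rule eq_matI)
  fix i j assume "i < dim_row (theta \<iota> ^ (CARD('f) ^ n) \<cdot>\<^sub>m 1\<^sub>m d + N)" "j < dim_col (theta \<iota> ^ (CARD('f) ^ n) \<cdot>\<^sub>m 1\<^sub>m d + N)"
  hence ij: "i < d" "j < d" using N by auto
  have "N $$ (i, j) ^ (CARD('f) ^ n) = N $$ (i, j)" using N(2)[OF ij] by auto
  thus "map_mat (\<lambda>x. x ^ (CARD('f) ^ n)) (theta \<iota> \<cdot>\<^sub>m 1\<^sub>m d + N) $$ (i, j) = (theta \<iota> ^ (CARD('f) ^ n) \<cdot>\<^sub>m 1\<^sub>m d + N) $$ (i, j)"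
    using ij N by (simp add: frob_add)
qed (use N in auto)

text \<open>With \<open>t = theta\<close> and \<open>t' = theta^(q^n)\<close> the scalar
  \<open>t - t'\<close> is \<open>D_n\<close>.\<close>

lemma theta_block_commutation:
  assumes N: "N \<in> carrier_mat d d" and Y: "Y \<in> carrier_mat d d" and Z: "Z \<in> carrier_mat d d"
  shows "Y * (t' \<cdot>\<^sub>m 1\<^sub>m d + N) + Z = (t \<cdot>\<^sub>m 1\<^sub>m d + N) * Y \<longleftrightarrow>
    (t - t') \<cdot>\<^sub>m Y + N * Y = Y * N + (Z :: 'c mat)"
proof -
  have 1: "Y * (t' \<cdot>\<^sub>m 1\<^sub>m d + N) = t' \<cdot>\<^sub>m Y + Y * N"
    using N Y by (subst mult_add_distrib_mat[of _ d d]) auto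
  have 2: "(t \<cdot>\<^sub>m 1\<^sub>m d + N) * Y = t \<cdot>\<^sub>m Y + N * Y"
    using N Y by (subst add_mult_distrib_mat[of _ d d]) auto
  have eq_iff: "A = B \<longleftrightarrow> (\<forall>i<d. \<forall>j<d. A $$ (i, j) = B $$ (i, j))"
    if "A \<in> carrier_mat d d" "B \<in> carrier_mat d d" for A B :: "'c mat"
    using that by (auto intro!: eq_matI)
  show ?thesis unfolding 1 2 using N Y Z
    by (subst (1 2) eq_iff) (auto simp: algebra_simps simp del: index_mult_mat(1))
qed

text \<open>Settles both definite descriptions at once: the two-sided inverse \<open>Q\<close> of
  \<open>P\<close> is the unique exponential, after which \<open>P\<close> is its unique
  inverse.\<close>

lemma tmod_log_eqI:
  assumes N: "N \<in> carrier_mat d d" "\<And>i j. i < d \<Longrightarrow> j < d \<Longrightarrow> N $$ (i, j) \<in> {0, 1}"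
      "\<And>i j. i < d \<Longrightarrow> j \<le> i \<Longrightarrow> N $$ (i, j) = 0"
    and R: "R \<in> tw_carrier d" "R 0 = theta \<iota> \<cdot>\<^sub>m 1\<^sub>m d + N"
    and P: "P \<in> tw_carrier d" "P 0 = 1\<^sub>m d" "tw_mult CARD('f) d P R = tw_mult CARD('f) d (tw_const d (R 0)) P"
  shows "tmod_log \<iota> d R = P"
proof -
  have R0: "R 0 \<in> carrier_mat d d" by (rule tw_carrierD(1)[OF R(1)])
  obtain Q where Q: "Q \<in> tw_carrier d" "Q 0 = 1\<^sub>m d"
    "tw_mult CARD('f) d P Q = tw_const d (1\<^sub>m d)" "tw_mult CARD('f) d Q P = tw_const d (1\<^sub>m d)"
    using tw_mult_inverse_exists[OF P(1,2)] by blast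
  have uniq: "Q' = Q" if "is_tmod_exp \<iota> d R Q'" for Q'
  proof -
    have Q': "Q' \<in> tw_carrier d" "Q' 0 = 1\<^sub>m d" "tw_mult CARD('f) d R Q' = tw_mult CARD('f) d Q' (tw_const d (R 0))"
      using that R by (simp_all add: is_tmod_exp_iff)
    define A where "A = tw_mult CARD('f) d P Q'"
    have A: "A \<in> tw_carrier d" by (simp add: A_def)
    have "tw_mult CARD('f) d A (tw_const d (R 0)) = tw_mult CARD('f) d P (tw_mult CARD('f) d R Q')"
      using R0 P Q' by (simp add: A_def tw_mult_assoc)
    also have "\<dots> = tw_mult CARD('f) d (tw_const d (R 0)) A"
      unfolding A_def tw_mult_assoc[OF P(1) R(1) Q'(1), symmetric] P(3)
      by (rule tw_mult_assoc) (use R0 P Q' in auto)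
    finally have comm: "tw_mult CARD('f) d A (tw_const d (R 0)) = tw_mult CARD('f) d (tw_const d (R 0)) A" .
    have "A n = tw_const d (1\<^sub>m d) n" for n
    proof (cases "n = 0")
      case True
      thus ?thesis using P Q' by (simp add: A_def tw_mult_0 tw_const_def)
    next
      case False
      have An: "A n \<in> carrier_mat d d" using A by (simp add: tw_carrierD(1))
      have "A n * (theta \<iota> ^ (CARD('f) ^ n) \<cdot>\<^sub>m 1\<^sub>m d + N) = (theta \<iota> \<cdot>\<^sub>m 1\<^sub>m d + N) * A n"
        using fun_cong[OF comm, of n] A R0
        by (simp add: tw_mult_const_left tw_mult_const_right R(2) theta_block_frob[OF N(1,2)])
      moreover have "(theta \<iota> \<cdot>\<^sub>m 1\<^sub>m d + N) * A n \<in> carrier_mat d d"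
        by (rule mult_carrier_mat[of _ d d]) (use N(1) An in auto)
      ultimately have syl: "(theta \<iota> - theta \<iota> ^ (CARD('f) ^ n)) \<cdot>\<^sub>m A n + N * A n = A n * N"
        using theta_block_commutation[OF N(1) An zero_carrier_mat[of d d], of "theta \<iota> ^ (CARD('f) ^ n)" "theta \<iota>"]
          An N(1) by (simp add: right_add_zero_mat[of _ d d])
      have "A n = 0\<^sub>m d d"
        by (rule sylvester_eq_0[OF N(1,3) An theta_diff_nonzero syl]) (use False in auto)
      thus ?thesis using False by (simp add: tw_const_def)
    qed
    hence PQ': "tw_mult CARD('f) d P Q' = tw_const d (1\<^sub>m d)" by (auto simp: A_def)
    have "Q' = tw_mult CARD('f) d (tw_mult CARD('f) d Q P) Q'" using Q Q' by simp
    also have "\<dots> = Q" using Q(1) P(1) Q'(1) by (simp only: tw_mult_assoc PQ' tw_mult_one_right)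
    finally show ?thesis .
  qed
  have "is_tmod_exp \<iota> d R Q"
  proof -
    \<comment> \<open>Multiplying \<open>P R = R_0 P\<close> by \<open>Q\<close> on both sides turns
      it into \<open>R Q = Q R_0\<close>.\<close>
    have "tw_mult CARD('f) d R Q = tw_mult CARD('f) d (tw_mult CARD('f) d Q P) (tw_mult CARD('f) d R Q)" using Q by simp
    also have "\<dots> = tw_mult CARD('f) d Q (tw_mult CARD('f) d (tw_mult CARD('f) d P R) Q)"
      using Q(1) P(1) R(1) by (simp only: tw_mult_assoc tw_mult_closed)
    also have "\<dots> = tw_mult CARD('f) d Q (tw_mult CARD('f) d (tw_const d (R 0)) (tw_mult CARD('f) d P Q))"
      using Q(1) P R0 by (simp only: tw_mult_assoc tw_mult_closed tw_const_closed)
    also have "\<dots> = tw_mult CARD('f) d Q (tw_const d (R 0))"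
      using Q R0 by simp
    finally show ?thesis using Q R by (simp add: is_tmod_exp_iff)
  qed
  hence exp: "tmod_exp \<iota> d R = Q"
    unfolding tmod_exp_def using uniq by (rule the_equality)
  show ?thesis unfolding tmod_log_def exp
  proof (rule the_equality)
    fix P' assume P': "P' \<in> tw_carrier d \<and> tw_mult CARD('f) d P' Q = tw_const d (1\<^sub>m d) \<and>
      tw_mult CARD('f) d Q P' = tw_const d (1\<^sub>m d)"
    hence "P' = tw_mult CARD('f) d P' (tw_mult CARD('f) d Q P)" using Q by simp
    also have "\<dots> = P" using P' Q(1) P(1) by (simp only: tw_mult_assoc[symmetric] tw_mult_one_left)
    finally show "P' = P" .
  qed (use P Q in auto)
qed

lemma tw_mult_degree_one:
  assumes A: "A \<in> tw_carrier d" and R: "(R :: nat \<Rightarrow> 'c mat) \<in> tw_carrier d" "\<And>n. n \<ge> 2 \<Longrightarrow> R n = 0\<^sub>m d d"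
  shows "tw_mult CARD('f) d A R (Suc n) =
    A (Suc n) * map_mat (\<lambda>x. x ^ (CARD('f) ^ Suc n)) (R 0) + A n * map_mat (\<lambda>x. x ^ (CARD('f) ^ n)) (R 1)" (is "_ = ?rhs")
proof (rule eq_matI)
  note dims = tw_carrierD[OF A, of n] tw_carrierD[OF A, of "Suc n"] tw_carrierD[OF R(1), of 0] tw_carrierD[OF R(1), of 1]
  fix i j assume "i < dim_row ?rhs" "j < dim_col ?rhs"
  hence ij: "i < d" "j < d" using dims by auto
  have "tw_mult CARD('f) d A R (Suc n) $$ (i, j) =
    (\<Sum>m\<le>Suc n. \<Sum>k<d. A m $$ (i, k) * (R (Suc n - m) $$ (k, j)) ^ (CARD('f) ^ m))"
    by (rule tw_mult_index[OF A R(1) ij])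
  also have "\<dots> = (\<Sum>m\<in>{n, Suc n}. \<Sum>k<d. A m $$ (i, k) * (R (Suc n - m) $$ (k, j)) ^ (CARD('f) ^ m))"
  proof (intro sum.mono_neutral_right ballI)
    fix m assume "m \<in> {..Suc n} - {n, Suc n}"
    hence "R (Suc n - m) = 0\<^sub>m d d" by (intro R(2)) auto
    thus "(\<Sum>k<d. A m $$ (i, k) * (R (Suc n - m) $$ (k, j)) ^ (CARD('f) ^ m)) = 0" using ij by simp
  qed auto
  also have "\<dots> = ?rhs $$ (i, j)"
    using ij dims by (simp add: scalar_prod_def lessThan_atLeast0)
  finally show "tw_mult CARD('f) d A R (Suc n) $$ (i, j) = ?rhs $$ (i, j)" .
qed (use tw_carrierD[OF A, of n] tw_carrierD[OF R(1), of 1] in \<open>auto simp: tw_mult_def\<close>)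

lemma tmod_log_recursion:
  assumes N: "N \<in> carrier_mat d d" "\<And>i j. i < d \<Longrightarrow> j < d \<Longrightarrow> N $$ (i, j) \<in> {0, 1}"
      "\<And>i j. i < d \<Longrightarrow> j \<le> i \<Longrightarrow> N $$ (i, j) = 0"
    and R: "R \<in> tw_carrier d" "R 0 = theta \<iota> \<cdot>\<^sub>m 1\<^sub>m d + N" "\<And>n. n \<ge> 2 \<Longrightarrow> R n = 0\<^sub>m d d"
  defines "P \<equiv> tmod_log \<iota> d R"
  shows "P \<in> tw_carrier d" "P 0 = 1\<^sub>m d"
    "(theta \<iota> - theta \<iota> ^ (CARD('f) ^ Suc n)) \<cdot>\<^sub>m P (Suc n) + N * P (Suc n) =
       P (Suc n) * N + P n * map_mat (\<lambda>x. x ^ (CARD('f) ^ n)) (R 1)"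
proof -
  let ?eq = "\<lambda>n Y Z. (theta \<iota> - theta \<iota> ^ (CARD('f) ^ Suc n)) \<cdot>\<^sub>m Y + N * Y = Y * N + Z * map_mat (\<lambda>x. x ^ (CARD('f) ^ n)) (R 1)"
  have R1: "R 1 \<in> carrier_mat d d" using R by (simp add: tw_carrierD(1))
  have step: "\<exists>Y. Y \<in> carrier_mat d d \<and> ?eq n Y Z" if "Z \<in> carrier_mat d d" for n Z
    using sylvester_exists[OF N(1,3) _ theta_diff_nonzero[of "Suc n"], of "Z * map_mat (\<lambda>x. x ^ (CARD('f) ^ n)) (R 1)"] that R1
    by auto
  \<comment> \<open>Each Sylvester equation is solvable for every right-hand side, so the
    coefficients can be chosen one after the other, starting from the identity.\<close>
  obtain P' where P': "\<And>n. P' n \<in> carrier_mat d d" "P' 0 = 1\<^sub>m d" "\<And>n. ?eq n (P' (Suc n)) (P' n)"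
  proof -
    have "\<exists>f. \<forall>n. (f n \<in> carrier_mat d d \<and> (n = 0 \<longrightarrow> f n = 1\<^sub>m d)) \<and> ?eq n (f (Suc n)) (f n)"
      by (rule dependent_nat_choice) (use step in auto)
    thus ?thesis using that by blast
  qed
  have car: "P' \<in> tw_carrier d" using P' by (simp add: tw_carrier_def)
  have R0: "R 0 \<in> carrier_mat d d" using tw_carrierD(1)[OF R(1)] .
  have "tw_mult CARD('f) d P' R n = tw_mult CARD('f) d (tw_const d (R 0)) P' n" for n
  proof (cases n)
    case 0
    thus ?thesis using car R0 R(1) P'(2) by (simp add: tw_mult_0 tw_const_def)
  next
    case (Suc m)
    have "P' m * map_mat (\<lambda>x. x ^ (CARD('f) ^ m)) (R 1) \<in> carrier_mat d d"
      by (rule mult_carrier_mat[OF P'(1)]) (use R1 in simp)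
    hence "P' n * (theta \<iota> ^ (CARD('f) ^ n) \<cdot>\<^sub>m 1\<^sub>m d + N) + P' m * map_mat (\<lambda>x. x ^ (CARD('f) ^ m)) (R 1) =
      (theta \<iota> \<cdot>\<^sub>m 1\<^sub>m d + N) * P' n"
      using P'(3)[of m] P'(1) unfolding Suc
      by (subst theta_block_commutation[OF N(1)]) simp_all
    thus ?thesis
      using tw_mult_degree_one[OF car R(1,3), of m] Suc car R0
      by (simp del: power_Suc add: tw_mult_const_left R(2) theta_block_frob[OF N(1,2)])
  qed
  hence "tmod_log \<iota> d R = P'"
    using car P'(2) by (intro tmod_log_eqI[OF N R(1,2)]) auto
  thus "P \<in> tw_carrier d" "P 0 = 1\<^sub>m d" "?eq n (P (Suc n)) (P n)"
    using car P' by (simp_all add: P_def)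
qed

end

section \<open>Convergence\<close>

text \<open>A block of consecutive terms is no larger than its largest term, so the partial sums of
  a null sequence are Cauchy.\<close>

lemma nonarch_summable:
  fixes f :: "nat \<Rightarrow> 'c::{nonarch_field,complete_space}"
  assumes "(\<lambda>n. absv (f n)) \<longlonglongrightarrow> 0"
  shows "summable f"
proof -
  have "Cauchy (\<lambda>n. sum f {..<n})"
  proof (rule metric_CauchyI)
    fix e :: real assume e: "e > 0"
    from assms e have "eventually (\<lambda>n. absv (f n) < e / 2) sequentially"
      by (intro order_tendstoD) auto
    then obtain M where M: "\<And>n. n \<ge> M \<Longrightarrow> absv (f n) < e / 2"
      by (auto simp: eventually_sequentially)
    have *: "dist (sum f {..<n}) (sum f {..<m}) < e" if "M \<le> m" "m \<le> n" for m n
    proof -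
      have "sum f {..<n} - sum f {..<m} = sum f {m..<n}"
        using that by (simp add: sum_diff_nat_ivl lessThan_atLeast0)
      hence "dist (sum f {..<n}) (sum f {..<m}) = absv (sum f {m..<n})"
        by (simp add: dist_eq_dist_diff_0[of "sum f {..<n}"])
      also have "\<dots> \<le> e / 2" using M that e by (intro absv_sum_le) (auto intro: less_imp_le)
      finally show ?thesis using e by simp
    qed
    show "\<exists>M. \<forall>m\<ge>M. \<forall>n\<ge>M. dist (sum f {..<m}) (sum f {..<n}) < e"
    proof (intro exI[of _ M] allI impI)
      fix m n assume "m \<ge> M" "n \<ge> M"
      thus "dist (sum f {..<m}) (sum f {..<n}) < e"
        using *[of m n] *[of n m] by (cases "m \<le> n") (auto simp: dist_commute)
    qed
  qed
  thus ?thesis by (simp add: summable_iff_convergent Cauchy_convergent_iff)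
qed

text \<open>Takes the place of absolute convergence: finitely many terms outside \<open>F n\<close>
  add up to at most the uniform bound, however many they are, so the limit along \<open>F n\<close>
  is the unordered sum.\<close>

lemma nonarch_has_sum:
  fixes f :: "'a \<Rightarrow> 'c::nonarch_field"
  assumes F: "\<And>n. finite (F n)" "\<And>n. F n \<subseteq> I"
    and tail: "\<And>n x. x \<in> I - F n \<Longrightarrow> absv (f x) \<le> \<epsilon> n" "\<epsilon> \<longlonglongrightarrow> 0"
    and lim: "(\<lambda>n. sum f (F n)) \<longlonglongrightarrow> S"
  shows "(f has_sum S) I"
  unfolding has_sum_def
proof (rule tendstoI)
  fix e :: real assume e: "e > 0"
  have "eventually (\<lambda>n. \<epsilon> n < e / 2) sequentially"
    using tail(2) e by (intro order_tendstoD) auto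
  moreover have "eventually (\<lambda>n. dist (sum f (F n)) S < e) sequentially"
    using lim e by (rule tendstoD)
  ultimately have "eventually (\<lambda>n. \<epsilon> n < e / 2 \<and> dist (sum f (F n)) S < e) sequentially"
    by (rule eventually_conj)
  then obtain n where n: "\<epsilon> n < e / 2" "dist (sum f (F n)) S < e"
    by (auto simp: eventually_sequentially)
  show "eventually (\<lambda>A. dist (sum f A) S < e) (finite_subsets_at_top I)"
    unfolding eventually_finite_subsets_at_top
  proof (intro exI[of _ "F n"] conjI allI impI)
    fix A assume A: "finite A \<and> F n \<subseteq> A \<and> A \<subseteq> I"
    have "sum f A - sum f (F n) = sum f (A - F n)" using A by (simp add: sum_diff)
    hence "dist (sum f A) (sum f (F n)) = absv (sum f (A - F n))"
      by (simp add: dist_eq_dist_diff_0[of "sum f A"])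
    also have "\<dots> \<le> e / 2"
    proof (rule absv_sum_le)
      fix x assume "x \<in> A - F n"
      thus "absv (f x) \<le> e / 2" using tail(1)[of x n] n(1) A by fastforce
    qed (use e in simp)
    finally have "dist (sum f A) (sum f (F n)) < e" using e by simp
    thus "dist (sum f A) S < e"
      using dist_ultrametric[of "sum f A" S "sum f (F n)"] n(2) by simp
  qed (use F in auto)
qed

section \<open>Truncated star polylogarithms\<close>

context C_infinity_field
begin

text \<open>Truncation by the largest index, which is the leading one because the tuples are weakly
  decreasing.\<close>

definition bounded_indices :: "nat \<Rightarrow> nat \<Rightarrow> nat list set" where
  "bounded_indices m M = {ns \<in> Li_star_indices m. set ns \<subseteq> {..M}}"

lemma finite_bounded_indices: "finite (bounded_indices m M)"
  by (rule finite_subset[OF _ finite_lists_length_eq[of "{..M}" m]])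
    (auto simp: bounded_indices_def Li_star_indices_def)

lemma bounded_indices_0: "bounded_indices 0 M = {[]}"
  by (auto simp: bounded_indices_def Li_star_indices_def)

lemma Cons_in_bounded_indices:
  "n # ns \<in> bounded_indices (Suc m) M \<longleftrightarrow> n \<le> M \<and> ns \<in> bounded_indices m n"
proof -
  have "n # ns \<in> bounded_indices (Suc m) M \<longleftrightarrow>
    length ns = m \<and> (\<forall>k\<in>set ns. k \<le> n) \<and> sorted_wrt (\<ge>) ns \<and> n \<le> M \<and> (\<forall>k\<in>set ns. k \<le> M)"
    by (auto simp: bounded_indices_def Li_star_indices_def)
  also have "\<dots> \<longleftrightarrow> n \<le> M \<and> length ns = m \<and> sorted_wrt (\<ge>) ns \<and> (\<forall>k\<in>set ns. k \<le> n)"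
    by (meson order_trans)
  also have "\<dots> \<longleftrightarrow> n \<le> M \<and> ns \<in> bounded_indices m n"
    by (auto simp: bounded_indices_def Li_star_indices_def)
  finally show ?thesis .
qed

text \<open>The leading index bounds the rest of the tuple, which makes the truncated sums
  recursive.\<close>

lemma bounded_indices_Suc:
  "bounded_indices (Suc m) M = (\<Union>n\<le>M. (#) n ` bounded_indices m n)"
proof (rule Set.set_eqI)
  fix ns
  show "ns \<in> bounded_indices (Suc m) M \<longleftrightarrow> ns \<in> (\<Union>n\<le>M. (#) n ` bounded_indices m n)"
  proof (cases ns)
    case Nil
    thus ?thesis by (auto simp: bounded_indices_def Li_star_indices_def)
  qed (auto simp: Cons_in_bounded_indices)
qed

definition L_quot :: "nat \<Rightarrow> 'c \<Rightarrow> nat \<Rightarrow> 'c" where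
  "L_quot t z n = z ^ (CARD('f) ^ n) / L \<iota> n ^ t"

lemma Li_star_term_Nil: "Li_star_term \<iota> [] [] [] = 1"
  by (simp add: Li_star_term_def)

lemma Li_star_term_Cons:
  "Li_star_term \<iota> (t # ts) (z # zs) (n # ns) = L_quot t z n * Li_star_term \<iota> ts zs ns"
  by (simp add: Li_star_term_def L_quot_def prod.lessThan_Suc_shift del: prod.lessThan_Suc)

definition Li_star_upto :: "nat list \<Rightarrow> 'c list \<Rightarrow> nat \<Rightarrow> 'c" where
  "Li_star_upto ts zs M = (\<Sum>ns\<in>bounded_indices (length ts) M. Li_star_term \<iota> ts zs ns)"

lemma Li_star_upto_Nil [simp]: "Li_star_upto [] [] M = 1"
  by (simp add: Li_star_upto_def bounded_indices_0 Li_star_term_Nil)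

lemma Li_star_upto_Cons:
  "Li_star_upto (t # ts) (z # zs) M = (\<Sum>n\<le>M. L_quot t z n * Li_star_upto ts zs n)"
proof -
  have "Li_star_upto (t # ts) (z # zs) M =
    (\<Sum>n\<le>M. \<Sum>ns\<in>(#) n ` bounded_indices (length ts) n. Li_star_term \<iota> (t # ts) (z # zs) ns)"
    unfolding Li_star_upto_def list.size(4) add_Suc_right bounded_indices_Suc add_0_right
    by (rule sum.UNION_disjoint) (auto simp: finite_bounded_indices)
  also have "\<dots> = (\<Sum>n\<le>M. L_quot t z n * Li_star_upto ts zs n)"
    by (intro sum.cong[OF refl], subst sum.reindex)
      (auto simp: Li_star_upto_def Li_star_term_Cons sum_distrib_left)
  finally show ?thesis .
qed

lemma L_0 [simp]: "L \<iota> 0 = 1"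
  by (simp add: L_def)

lemma L_Suc: "L \<iota> (Suc n) = L \<iota> n * (theta \<iota> - theta \<iota> ^ (CARD('f) ^ Suc n))"
  by (simp add: L_def)

lemma absv_L: "absv (L \<iota> n) = real CARD('f) ^ (\<Sum>j=1..n. CARD('f) ^ j)"
  by (simp add: L_def absv_prod absv_theta_diff power_sum)

lemma L_nonzero: "L \<iota> n \<noteq> 0"
  using theta_diff_nonzero by (simp add: L_def)

text \<open>The threshold in the hypotheses on \<open>u\<close>: at this value of \<open>|z|\<close>
  the quotient \<open>|z|^(q^n) / |L_n|^t\<close> passes from decay to growth in n.\<close>

definition radius :: "nat \<Rightarrow> real" where
  "radius t = real CARD('f) powr (real t * real CARD('f) / (real CARD('f) - 1))"

lemma radius_pos: "radius t > 0"
  by (simp add: radius_def)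

text \<open>The exponent of \<open>|L_n|\<close> is the geometric sum
  \<open>(q^(n+1) - q) / (q - 1)\<close>, so \<open>|L_n|^t\<close> equals
  \<open>radius t ^ (q^n) / radius t\<close>.\<close>

lemma absv_L_quot:
  "absv (L_quot t z n) = (absv z / radius t) ^ (CARD('f) ^ n) * radius t"
proof -
  define q where "q = real CARD('f)"
  have q: "q \<ge> 2" using card_ge_2 by (simp add: q_def)
  define S where "S = (\<Sum>j=1..n. CARD('f) ^ j)"
  have S: "(q - 1) * real S = q ^ Suc n - q"
    unfolding S_def q_def by (induction n) (simp_all add: algebra_simps)
  define e where "e = real t * q / (q - 1)"
  have rad: "radius t = q powr e" by (simp add: radius_def e_def q_def)
  have "e * q ^ n = real t * (q * q ^ n) / (q - 1)" by (simp add: e_def)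
  also have "q * q ^ n = q + (q - 1) * real S" using S by simp
  also have "real t * \<dots> / (q - 1) = (real t * q + real (S * t) * (q - 1)) / (q - 1)"
    by (simp add: algebra_simps)
  also have "\<dots> = e + real (S * t)" using q by (simp add: e_def add_divide_distrib)
  finally have e: "real (CARD('f) ^ n) * e = e + real (S * t)" by (simp add: q_def mult.commute)
  have "radius t ^ (CARD('f) ^ n) = q powr (real (CARD('f) ^ n) * e)"
    unfolding rad using q by (intro powr_power) auto
  also have "\<dots> = radius t * (q ^ S) ^ t"
    unfolding e rad powr_add power_mult[symmetric] using q by (subst powr_realpow) auto
  finally have K: "radius t * (q ^ S) ^ t = radius t ^ (CARD('f) ^ n)" ..
  have "absv (L_quot t z n) = absv z ^ (CARD('f) ^ n) / (q ^ S) ^ t"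
    by (simp only: L_quot_def absv_divide absv_power absv_L q_def S_def)
  also have "\<dots> = absv z ^ (CARD('f) ^ n) / (radius t * (q ^ S) ^ t) * radius t"
    using radius_pos[of t] by simp
  finally show ?thesis by (simp only: K power_divide)
qed

lemma absv_L_quot_le:
  assumes "absv z \<le> radius t"
  shows "absv (L_quot t z n) \<le> radius t"
  unfolding absv_L_quot using assms radius_pos[of t]
  by (intro mult_left_le_one_le power_le_one) (auto simp: field_simps)

lemma L_quot_tendsto_0:
  assumes "absv z < radius t"
  shows "(\<lambda>n. absv (L_quot t z n)) \<longlonglongrightarrow> 0"
proof -
  let ?x = "absv z / radius t"
  have x: "0 \<le> ?x" "?x < 1" using assms radius_pos[of t] by (auto simp: field_simps)
  have "strict_mono (\<lambda>n. CARD('f) ^ n)"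
    using card_ge_2 by (intro strict_monoI power_strict_increasing) auto
  hence "filterlim (\<lambda>n. CARD('f) ^ n) sequentially sequentially"
    by (rule filterlim_subseq)
  hence "(\<lambda>n. ?x ^ (CARD('f) ^ n)) \<longlonglongrightarrow> 0"
    by (rule filterlim_compose[OF LIMSEQ_realpow_zero[OF x]])
  from tendsto_mult_left_zero[OF this, of "radius t"] show ?thesis
    by (simp add: absv_L_quot)
qed

lemma absv_Li_star_term_le:
  assumes "length ts = length zs" "length ns = length ts"
    and "\<And>j. j < length ts \<Longrightarrow> absv (zs ! j) \<le> radius (ts ! j)"
  shows "absv (Li_star_term \<iota> ts zs ns) \<le> (\<Prod>t\<leftarrow>ts. radius t)"
  using assms
proof (induction ts zs arbitrary: ns rule: list_induct2)
  case Nil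
  thus ?case by (simp add: Li_star_term_Nil)
next
  case (Cons t ts z zs)
  obtain n ns' where ns: "ns = n # ns'" "length ns' = length ts"
    using Cons.prems(1) by (cases ns) auto
  have "absv (L_quot t z n) \<le> radius t"
    using Cons.prems(2)[of 0] by (intro absv_L_quot_le) simp
  moreover have "absv (Li_star_term \<iota> ts zs ns') \<le> (\<Prod>t\<leftarrow>ts. radius t)"
    using Cons.prems(2)[of "Suc _"] ns by (intro Cons.IH) auto
  ultimately show ?case
    using radius_pos[of t] by (simp add: ns Li_star_term_Cons dist_mult_0 mult_mono)
qed

text \<open>A tuple outside the truncation at \<open>M\<close> has leading index above
  \<open>M\<close>; its first factor is at most as large as the one at \<open>M\<close>, which tends
  to 0, and the remaining factors are bounded uniformly.\<close>

lemma Li_star_has_sum: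
  assumes "length ts = length zs" "absv z < radius t"
    and "\<And>j. j < length ts \<Longrightarrow> absv (zs ! j) \<le> radius (ts ! j)"
    and lim: "Li_star_upto (t # ts) (z # zs) \<longlonglongrightarrow> S"
  shows "(Li_star_term \<iota> (t # ts) (z # zs) has_sum S) (Li_star_indices (length (t # ts)))"
proof -
  define B where "B = (\<Prod>t\<leftarrow>ts. radius t)"
  have B: "B \<ge> 0" unfolding B_def by (induction ts) (auto simp: less_imp_le[OF radius_pos])
  have x: "absv z / radius t \<ge> 0" "absv z / radius t \<le> 1"
    using assms(2) radius_pos[of t] by (auto simp: field_simps)
  show ?thesis
  proof (rule nonarch_has_sum[where F = "bounded_indices (length (t # ts))" and
        \<epsilon> = "\<lambda>n. absv (L_quot t z n) * B"])
    fix M ns assume ns: "ns \<in> Li_star_indices (length (t # ts)) - bounded_indices (length (t # ts)) M"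
    then obtain n ns' where [simp]: "ns = n # ns'"
      by (cases ns) (auto simp: Li_star_indices_def)
    have "n > M"
    proof (rule ccontr)
      assume "\<not> n > M"
      moreover have "k \<le> n" if "k \<in> set ns'" for k
        using ns that by (simp add: Li_star_indices_def)
      ultimately have "set ns \<subseteq> {..M}" by force
      thus False using ns by (simp add: bounded_indices_def)
    qed
    hence "absv (L_quot t z n) \<le> absv (L_quot t z M)"
      unfolding absv_L_quot using x radius_pos[of t] card_ge_2
      by (intro mult_right_mono power_decreasing power_increasing) auto
    moreover have "absv (Li_star_term \<iota> ts zs ns') \<le> B"
      unfolding B_def using ns assms by (intro absv_Li_star_term_le) (auto simp: Li_star_indices_def)
    ultimately show "absv (Li_star_term \<iota> (t # ts) (z # zs) ns) \<le> absv (L_quot t z M) * B"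
      by (simp add: Li_star_term_Cons dist_mult_0 mult_mono)
  next
    show "(\<lambda>n. absv (L_quot t z n) * B) \<longlonglongrightarrow> 0"
      by (rule tendsto_mult_left_zero[OF L_quot_tendsto_0[OF assms(2)]])
    show "(\<lambda>M. sum (Li_star_term \<iota> (t # ts) (z # zs)) (bounded_indices (length (t # ts)) M)) \<longlonglongrightarrow> S"
      using lim unfolding Li_star_upto_def .
  qed (simp_all only: finite_bounded_indices, auto simp: bounded_indices_def)
qed

end

section \<open>The t-module of the star polylogarithms\<close>

text \<open>The shift matrix has gaps at the columns where a new block begins; these are located by
  the partial sums of the sizes.\<close>

lemma diag_shift_blocks_index:
  assumes "i < sum_list ds" "j < sum_list ds"
  shows "diag_block_mat (map (\<lambda>d. mat d d (\<lambda>(i, j). if j = i + 1 then 1 else 0)) ds) $$ (i, j) =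
    (if j = i + 1 \<and> (\<forall>k\<le>length ds. j \<noteq> sum_list (take k ds)) then 1 else (0 :: 'a::zero_neq_one))"
  using assms
proof (induction ds arbitrary: i j)
  case (Cons d ds)
  let ?B = "diag_block_mat (map (\<lambda>d. mat d d (\<lambda>(i, j). if j = i + 1 then 1 else 0 :: 'a)) ds)"
  have dims: "dim_row ?B = sum_list ds" "dim_col ?B = sum_list ds"
    by (simp_all add: dim_diag_block_mat o_def)
  have ends: "(\<forall>k\<le>length (d # ds). j \<noteq> sum_list (take k (d # ds))) \<longleftrightarrow>
      j \<noteq> 0 \<and> (\<forall>k\<le>length ds. j \<noteq> d + sum_list (take k ds))"
    by (simp add: All_less_Suc2 flip: less_Suc_eq_le)
  have entry: "diag_block_mat (map (\<lambda>d. mat d d (\<lambda>(i, j). if j = i + 1 then 1 else 0)) (d # ds)) $$ (i, j) =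
      (if i < d then if j < d then if j = i + 1 then 1 else 0 else 0
       else if j < d then 0 else ?B $$ (i - d, j - d))"
    using Cons.prems dims unfolding list.map diag_block_mat.simps Let_def
    by (subst index_mat_four_block) auto
  show ?case
  proof (cases "i < d \<or> j < d")
    case True
    have "\<exists>k\<le>length ds. j = d + sum_list (take k ds)" if "j = d"
      using that by (intro exI[of _ 0]) simp
    thus ?thesis using True unfolding entry ends by auto
  next
    case False
    have "j \<noteq> d + x \<longleftrightarrow> j - d \<noteq> x" for x using False by auto
    moreover have "j = i + 1 \<longleftrightarrow> j - d = i - d + 1" using False by auto
    moreover have "?B $$ (i - d, j - d) =
      (if j - d = i - d + 1 \<and> (\<forall>k\<le>length ds. j - d \<noteq> sum_list (take k ds)) then 1 else 0)"
      using Cons.prems False by (intro Cons.IH) auto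
    ultimately show ?thesis unfolding entry ends using False by auto
  qed
qed simp

section \<open>Positions and sizes of the blocks\<close>

lemma blk_end_0 [simp]: "blk_end r s 0 = 0"
  by (simp add: blk_end_def)

lemma blk_end_Suc: "blk_end r s (Suc m) = blk_end r s m + blk_dim r s (Suc m)"
  by (simp add: blk_end_def)

lemma blk_dim_Suc: "m \<le> r \<Longrightarrow> blk_dim r s m = s m + blk_dim r s (Suc m)"
  by (simp add: blk_dim_def sum.atLeast_Suc_atMost)

lemma blk_dim_last: "blk_dim r s r = s r"
  by (simp add: blk_dim_def)

lemma sum_list_take_blk_dim:
  assumes "k \<le> r"
  shows "sum_list (take k (map (blk_dim r s) [1..<Suc r])) = blk_end r s k"
proof -
  have "take k (map (blk_dim r s) [1..<Suc r]) = map (blk_dim r s) [1..<Suc k]"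
    using assms by (simp add: take_map take_upt del: upt_Suc)
  thus ?thesis
    by (simp add: blk_end_def interv_sum_list_conv_sum_set_nat atLeastLessThanSuc_atLeastAtMost del: upt_Suc)
qed

lemma G_N_carrier: "G_N r s \<in> carrier_mat (G_dim r s) (G_dim r s)"
  using sum_list_take_blk_dim[of r r s]
  by (auto simp: G_N_def G_dim_def dim_diag_block_mat o_def simp del: upt_Suc)

lemma G_N_index:
  assumes "i < G_dim r s" "j < G_dim r s"
  shows "G_N r s $$ (i, j) = (if j = i + 1 \<and> (\<forall>k\<le>r. j \<noteq> blk_end r s k) then 1 else 0)"
proof -
  have "sum_list (map (blk_dim r s) [1..<Suc r]) = G_dim r s"
    using sum_list_take_blk_dim[of r r s] by (simp add: G_dim_def del: upt_Suc)
  thus ?thesis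
    using diag_shift_blocks_index[of i "map (blk_dim r s) [1..<Suc r]" j] assms sum_list_take_blk_dim[of _ r s]
    by (simp add: G_N_def o_def del: upt_Suc)
qed

text \<open>\<open>y t\<close> stands for the t-th power of the inverse of \<open>D + N\<close>
  applied to \<open>y 0\<close>, and \<open>Z\<close> marks the block boundaries, across which
  \<open>N\<close> does not act. Solving upwards from the bottom row, the term from the row below
  already carries one more division by \<open>D\<close>, so \<open>absv D >= 1\<close> keeps it
  within the bound.\<close>

lemma shift_chain_bound:
  fixes y :: "nat \<Rightarrow> nat \<Rightarrow> 'c::nonarch_field"
  assumes D: "absv D \<ge> 1"
    and step: "\<And>t i. t < T \<Longrightarrow> i < d \<Longrightarrow> D * y (Suc t) i + (if Z (Suc i) then 0 else y (Suc t) (Suc i)) = y t i"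
    and last: "Z d"
    and init: "\<And>i. i < d \<Longrightarrow> absv (y 0 i) \<le> B" and B: "B \<ge> 0"
    and t: "t \<le> T" "i < d"
  shows "absv (y t i) \<le> B / absv D ^ t"
  using t
proof (induction t arbitrary: i)
  case 0
  thus ?case using init by simp
next
  case (Suc t)
  have D0: "absv D > 0" using D by linarith
  have le: "B / absv D ^ Suc t \<le> B / absv D ^ t"
    using B D by (intro divide_left_mono power_increasing mult_pos_pos zero_less_power D0) auto
  from Suc.prems(2) show ?case
  proof (induction "d - i" arbitrary: i rule: less_induct)
    case less
    have "D * y (Suc t) i = y t i - (if Z (Suc i) then 0 else y (Suc t) (Suc i))"
      using step[of t i] Suc.prems(1) less.prems by (simp add: algebra_simps)
    hence "absv D * absv (y (Suc t) i) = absv (y t i - (if Z (Suc i) then 0 else y (Suc t) (Suc i)))"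
      by (metis dist_mult_0)
    also have "\<dots> \<le> B / absv D ^ t"
    proof (rule order_trans[OF absv_diff_le max.boundedI])
      show "absv (y t i) \<le> B / absv D ^ t" using Suc less.prems by simp
      show "absv (if Z (Suc i) then 0 else y (Suc t) (Suc i)) \<le> B / absv D ^ t"
      proof (cases "Z (Suc i)")
        case False
        hence "Suc i \<noteq> d" using last by auto
        hence "absv (y (Suc t) (Suc i)) \<le> B / absv D ^ Suc t" using less by simp
        thus ?thesis using False le by simp
      qed (use B D0 in simp)
    qed
    finally show ?case using D0 by (simp add: field_simps)
  qed
qed

locale star_module = C_infinity_field \<iota>
  for \<iota> :: "'f::{finite,Fields.field} fls alg_closure \<Rightarrow> 'c::{nonarch_field,complete_space}" +
  fixes r :: nat and s :: "nat \<Rightarrow> nat" and u :: "nat \<Rightarrow> 'c"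
  assumes r_pos: "r \<ge> 1" and s_pos: "\<And>i. i \<in> {1..r} \<Longrightarrow> s i \<ge> 1"
begin

lemma blk_dim_pos: "1 \<le> m \<Longrightarrow> m \<le> r \<Longrightarrow> blk_dim r s m \<ge> 1"
  using blk_dim_Suc[of m r s] s_pos[of m] by simp

lemma blk_end_less: "m < m' \<Longrightarrow> m' \<le> r \<Longrightarrow> blk_end r s m < blk_end r s m'"
proof (induction m')
  case (Suc m')
  thus ?case using blk_dim_pos[of "Suc m'"] by (cases "m = m'") (auto simp: blk_end_Suc)
qed simp

lemma blk_end_eq_iff: "m \<le> r \<Longrightarrow> m' \<le> r \<Longrightarrow> blk_end r s m = blk_end r s m' \<longleftrightarrow> m = m'"
  using blk_end_less[of m m'] blk_end_less[of m' m] by (cases m m' rule: linorder_cases) auto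

lemma blk_end_le: "m \<le> m' \<Longrightarrow> m' \<le> r \<Longrightarrow> blk_end r s m \<le> blk_end r s m'"
  using blk_end_less[of m m'] by (cases "m = m'") auto

lemma blk_end_pos: "1 \<le> m \<Longrightarrow> m \<le> r \<Longrightarrow> blk_end r s m \<ge> 1"
  using blk_end_less[of 0 m] by simp

lemma blk_end_le_dim: "m \<le> r \<Longrightarrow> blk_end r s m \<le> G_dim r s"
  by (simp add: G_dim_def blk_end_le)

text \<open>Block boundaries counted from 0: column \<open>j\<close> opens a block iff
  \<open>is_end j\<close>, and row \<open>i\<close> closes one iff
  \<open>is_end (Suc i)\<close>.\<close>

definition is_end :: "nat \<Rightarrow> bool" where
  "is_end j \<longleftrightarrow> (\<exists>k\<le>r. j = blk_end r s k)"

lemma is_end_0 [simp]: "is_end 0" and is_end_dim [simp]: "is_end (G_dim r s)"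
  and is_end_blk_end [simp]: "k \<le> r \<Longrightarrow> is_end (blk_end r s k)"
  unfolding is_end_def G_dim_def by (auto intro: exI[of _ 0])

lemma not_is_end_inner:
  assumes "Suc m \<le> r" "0 < t" "t < blk_dim r s (Suc m)"
  shows "\<not> is_end (blk_end r s m + t)"
proof
  assume "is_end (blk_end r s m + t)"
  then obtain k where k: "k \<le> r" "blk_end r s m + t = blk_end r s k" by (auto simp: is_end_def)
  show False
  proof (cases "k \<le> m")
    case True
    thus False using blk_end_le[of k m] assms k by simp
  next
    case False
    thus False using blk_end_le[of "Suc m" k] assms k by (simp add: blk_end_Suc)
  qed
qed

text \<open>The columns of \<open>E\<close> and the vector \<open>v\<close> are supported in the
  last rows of blocks, so multiplying \<open>P_n\<close> by them picks out the last columns of its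
  blocks.\<close>

lemma sum_blk_ends:
  assumes "A \<subseteq> {1..r}"
  shows "(\<Sum>k<G_dim r s. f k * (\<Sum>l\<in>A. if k + 1 = blk_end r s l then g l else 0)) =
    (\<Sum>l\<in>A. f (blk_end r s l - 1) * (g l :: 'c))"
proof -
  have "(\<Sum>k<G_dim r s. f k * (\<Sum>l\<in>A. if k + 1 = blk_end r s l then g l else 0)) =
    (\<Sum>l\<in>A. \<Sum>k<G_dim r s. f k * (if k + 1 = blk_end r s l then g l else 0))"
    by (simp only: sum_distrib_left) (rule sum.swap)
  also have "\<dots> = (\<Sum>l\<in>A. f (blk_end r s l - 1) * g l)"
  proof (rule sum.cong[OF refl])
    fix l assume "l \<in> A"
    hence l: "blk_end r s l \<ge> 1" "blk_end r s l \<le> G_dim r s"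
      using assms blk_end_pos[of l] blk_end_le_dim[of l] by auto
    have "(\<Sum>k<G_dim r s. f k * (if k + 1 = blk_end r s l then g l else 0)) =
      (\<Sum>k\<in>{blk_end r s l - 1}. f k * (if k + 1 = blk_end r s l then g l else 0))"
      using l by (intro sum.mono_neutral_right) auto
    thus "(\<Sum>k<G_dim r s. f k * (if k + 1 = blk_end r s l then g l else 0)) = f (blk_end r s l - 1) * g l"
      using l by simp
  qed
  finally show ?thesis .
qed

lemma frob_if: "(if b then x else 0) ^ (CARD('f) ^ n) = (if b then x ^ (CARD('f) ^ n) else (0::'c))"
  by simp

text \<open>The entry of the block E[lm]. Multiplied by \<open>u r\<close>,
  \<open>coupling l r\<close> is the coordinate of \<open>v\<close> at the end of block l, which
  ties the logarithm at \<open>v\<close> to the same combinations of columns as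
  \<open>E\<close>.\<close>

definition coupling :: "nat \<Rightarrow> nat \<Rightarrow> 'c" where
  "coupling l m = (- 1) ^ (m - l) * (\<Prod>e=l..<m. u e)"

lemma coupling_same [simp]: "coupling l l = 1"
  by (simp add: coupling_def)

lemma coupling_Suc: "l \<le> m \<Longrightarrow> coupling l (Suc m) = - u m * coupling l m"
  by (simp add: coupling_def Suc_diff_le)

lemma G_E_inner:
  assumes "\<not> is_end j" "i < G_dim r s" "j < G_dim r s"
  shows "G_E r s u $$ (i, j) = 0"
proof -
  have "j \<noteq> blk_end r s (m - 1)" if "m \<le> r" for m
    using assms(1) that by (auto simp: is_end_def)
  thus ?thesis using assms by (simp add: G_E_def)
qed

lemma G_E_start:
  assumes "Suc m \<le> r" "i < G_dim r s"
  shows "G_E r s u $$ (i, blk_end r s m) =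
    (\<Sum>l=1..Suc m. if i + 1 = blk_end r s l then coupling l (Suc m) else 0)"
proof -
  have lt: "blk_end r s m < G_dim r s"
    using blk_end_less[of m r] assms by (simp add: G_dim_def)
  have inner: "(\<Sum>m'=l..r. if i + 1 = blk_end r s l \<and> blk_end r s m = blk_end r s (m' - 1) then coupling l m' else 0) =
    (if l \<le> Suc m then if i + 1 = blk_end r s l then coupling l (Suc m) else 0 else 0)" (is "?lhs l = _")
    if l: "l \<ge> 1" for l
  proof -
    \<comment> \<open>Distinct blocks start in distinct columns, so only \<open>m' = Suc m\<close>
      contributes.\<close>
    have "?lhs l = (\<Sum>m'=l..r. if m' = Suc m then if i + 1 = blk_end r s l then coupling l (Suc m) else 0 else 0)"
      using l assms by (intro sum.cong[OF refl]) (auto simp: blk_end_eq_iff)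
    thus ?thesis using assms by simp
  qed
  have "G_E r s u $$ (i, blk_end r s m) = (\<Sum>l=1..r. \<Sum>m'=l..r.
      if i + 1 = blk_end r s l \<and> blk_end r s m = blk_end r s (m' - 1) then coupling l m' else 0)"
    using assms lt by (simp add: G_E_def coupling_def cong: if_cong)
  also have "\<dots> = (\<Sum>l=1..r. if l \<le> Suc m then if i + 1 = blk_end r s l then coupling l (Suc m) else 0 else 0)"
    by (intro sum.cong[OF refl] inner) simp
  also have "\<dots> = (\<Sum>l\<in>{1..r} \<inter> {l. l \<le> Suc m}. if i + 1 = blk_end r s l then coupling l (Suc m) else 0)"
    by (subst sum.inter_restrict) auto
  also have "{1..r} \<inter> {l. l \<le> Suc m} = {1..Suc m}" using assms by auto
  finally show ?thesis .
qed

section \<open>Recursion for the columns of the logarithm coefficients\<close>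

abbreviation P :: "nat \<Rightarrow> 'c mat" where
  "P \<equiv> tmod_log \<iota> (G_dim r s) (G_rho_t \<iota> r s u)"

abbreviation D :: "nat \<Rightarrow> 'c" where
  "D n \<equiv> theta \<iota> - theta \<iota> ^ (CARD('f) ^ n)"

lemma G_rho_t_carrier: "G_rho_t \<iota> r s u \<in> tw_carrier (G_dim r s)"
  using G_N_carrier[of r s] by (auto simp: tw_carrier_def G_rho_t_def G_E_def intro!: add_carrier_mat)

lemma log_coeffs:
  shows P_carrier: "P \<in> tw_carrier (G_dim r s)" and P_0: "P 0 = 1\<^sub>m (G_dim r s)"
    and P_Suc: "D (Suc n) \<cdot>\<^sub>m P (Suc n) + G_N r s * P (Suc n) =
      P (Suc n) * G_N r s + P n * map_mat (\<lambda>x. x ^ (CARD('f) ^ n)) (G_E r s u)"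
proof -
  have N: "G_N r s $$ (i, j) \<in> {0, 1}" if "i < G_dim r s" "j < G_dim r s" for i j
    using that by (simp add: G_N_index)
  have N': "G_N r s $$ (i, j) = 0" if "i < G_dim r s" "j \<le> i" for i j
    using that by (simp add: G_N_index)
  have R: "G_rho_t \<iota> r s u n = 0\<^sub>m (G_dim r s) (G_dim r s)" if "n \<ge> 2" for n
    using that by (simp add: G_rho_t_def)
  have R0: "G_rho_t \<iota> r s u 0 = theta \<iota> \<cdot>\<^sub>m 1\<^sub>m (G_dim r s) + G_N r s"
    by (simp add: G_rho_t_def)
  have R1: "G_rho_t \<iota> r s u 1 = G_E r s u" by (simp add: G_rho_t_def)
  note * = tmod_log_recursion[OF G_N_carrier N N' G_rho_t_carrier R0 R, unfolded R1]
  show "P \<in> tw_carrier (G_dim r s)" "P 0 = 1\<^sub>m (G_dim r s)"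
    "D (Suc n) \<cdot>\<^sub>m P (Suc n) + G_N r s * P (Suc n) =
      P (Suc n) * G_N r s + P n * map_mat (\<lambda>x. x ^ (CARD('f) ^ n)) (G_E r s u)"
    by (rule *; assumption)+
qed

definition last_col :: "nat \<Rightarrow> nat \<Rightarrow> nat \<Rightarrow> 'c" where
  "last_col n m i = P n $$ (i, blk_end r s m - 1)"

text \<open>
  These combinations of the last columns of the blocks are the nonzero columns of \<open>P\<^sub>n E\<^sup>(\<^sup>n\<^sup>)\<close>; the one
  for the block \<open>r\<close>, multiplied by \<open>u\<^sub>r\<close> to the power \<open>q\<^sup>n\<close>, is \<open>P\<^sub>n v\<^sup>(\<^sup>n\<^sup>)\<close>.
\<close>

definition coupled_col :: "nat \<Rightarrow> nat \<Rightarrow> nat \<Rightarrow> 'c" where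
  "coupled_col n m i = (\<Sum>l=1..m. last_col n l i * coupling l m ^ (CARD('f) ^ n))"

lemma coupled_col_0 [simp]: "coupled_col n 0 i = 0"
  by (simp add: coupled_col_def)

text \<open>At \<open>m = 0\<close> the value \<open>u 0\<close>, outside the tuple, is multiplied
  by \<open>coupled_col n 0 i = 0\<close>.\<close>

lemma coupled_col_Suc: "coupled_col n (Suc m) i = last_col n (Suc m) i - u m ^ (CARD('f) ^ n) * coupled_col n m i"
proof -
  have "coupled_col n (Suc m) i = last_col n (Suc m) i + (\<Sum>l=1..m. last_col n l i * coupling l (Suc m) ^ (CARD('f) ^ n))"
    by (simp add: coupled_col_def)
  also have "(\<Sum>l=1..m. last_col n l i * coupling l (Suc m) ^ (CARD('f) ^ n)) = - (u m ^ (CARD('f) ^ n) * coupled_col n m i)"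
    unfolding coupled_col_def sum_distrib_left sum_negf[symmetric]
    by (intro sum.cong[OF refl]) (simp add: coupling_Suc power_mult_distrib frob_minus mult_ac)
  finally show ?thesis by simp
qed

text \<open>\<open>N\<close> on the left reaches for the row below unless the row closes a block, on
  the right for the previous column unless the column opens one. Column 0 opens a block, so
  \<open>j - 1\<close> never enters at \<open>j = 0\<close>.\<close>

lemma P_entry_eq:
  assumes i: "i < G_dim r s" and j: "j < G_dim r s"
  shows "D (Suc n) * P (Suc n) $$ (i, j) + (if is_end (Suc i) then 0 else P (Suc n) $$ (Suc i, j)) =
    (if is_end j then 0 else P (Suc n) $$ (i, j - 1)) +
    (\<Sum>k<G_dim r s. P n $$ (i, k) * (G_E r s u $$ (k, j)) ^ (CARD('f) ^ n))"
proof -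
  have E: "dim_row (G_E r s u) = G_dim r s" "dim_col (G_E r s u) = G_dim r s"
    by (simp_all add: G_E_def)
  have N: "dim_row (G_N r s :: 'c mat) = G_dim r s" "dim_col (G_N r s :: 'c mat) = G_dim r s"
    using carrier_matD[OF G_N_carrier] by blast+
  note dims = tw_carrierD(2,3)[OF P_carrier] N
  have "(G_N r s * P (Suc n)) $$ (i, j) = (\<Sum>k<G_dim r s. G_N r s $$ (i, k) * P (Suc n) $$ (k, j))"
    using i j dims by (auto simp: scalar_prod_def lessThan_atLeast0)
  also have "\<dots> = (\<Sum>k<G_dim r s. if k = Suc i then if is_end (Suc i) then 0 else P (Suc n) $$ (Suc i, j) else 0)"
    using i by (intro sum.cong[OF refl]) (auto simp: G_N_index is_end_def)
  also have "\<dots> = (if is_end (Suc i) then 0 else P (Suc n) $$ (Suc i, j))"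
  proof (cases "is_end (Suc i)")
    case False
    hence "Suc i \<noteq> G_dim r s" by (metis is_end_dim)
    thus ?thesis using i by simp
  qed simp
  finally have 1: "(G_N r s * P (Suc n)) $$ (i, j) = (if is_end (Suc i) then 0 else P (Suc n) $$ (Suc i, j))" .
  have "(P (Suc n) * G_N r s) $$ (i, j) = (\<Sum>k<G_dim r s. P (Suc n) $$ (i, k) * G_N r s $$ (k, j))"
    using i j dims by (auto simp: scalar_prod_def lessThan_atLeast0)
  also have "\<dots> = (\<Sum>k<G_dim r s. if k = j - 1 then if is_end j then 0 else P (Suc n) $$ (i, j - 1) else 0)"
  proof (intro sum.cong[OF refl])
    fix k assume k: "k \<in> {..<G_dim r s}"
    have "is_end j" if "j = 0" using that by simp
    thus "P (Suc n) $$ (i, k) * G_N r s $$ (k, j) =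
      (if k = j - 1 then if is_end j then 0 else P (Suc n) $$ (i, j - 1) else 0)"
      using j k by (cases j) (auto simp: G_N_index is_end_def)
  qed
  also have "\<dots> = (if is_end j then 0 else P (Suc n) $$ (i, j - 1))"
    using j by (simp add: less_imp_diff_less)
  finally have 2: "(P (Suc n) * G_N r s) $$ (i, j) = (if is_end j then 0 else P (Suc n) $$ (i, j - 1))" .
  have 3: "(P n * map_mat (\<lambda>x. x ^ (CARD('f) ^ n)) (G_E r s u)) $$ (i, j) =
    (\<Sum>k<G_dim r s. P n $$ (i, k) * (G_E r s u $$ (k, j)) ^ (CARD('f) ^ n))"
    using i j dims E by (auto simp: scalar_prod_def lessThan_atLeast0)
  have "(D (Suc n) \<cdot>\<^sub>m P (Suc n) + G_N r s * P (Suc n)) $$ (i, j) =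
    (P (Suc n) * G_N r s + P n * map_mat (\<lambda>x. x ^ (CARD('f) ^ n)) (G_E r s u)) $$ (i, j)"
    by (simp only: P_Suc)
  moreover have "(D (Suc n) \<cdot>\<^sub>m P (Suc n) + G_N r s * P (Suc n)) $$ (i, j) =
      D (Suc n) * P (Suc n) $$ (i, j) + (G_N r s * P (Suc n)) $$ (i, j)"
    using i j dims by (simp del: index_mult_mat(1))
  moreover have "(P (Suc n) * G_N r s + P n * map_mat (\<lambda>x. x ^ (CARD('f) ^ n)) (G_E r s u)) $$ (i, j) =
      (P (Suc n) * G_N r s) $$ (i, j) + (P n * map_mat (\<lambda>x. x ^ (CARD('f) ^ n)) (G_E r s u)) $$ (i, j)"
    using i j dims E by (simp del: index_mult_mat(1))
  ultimately show ?thesis by (simp only: 1 2 3)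
qed

text \<open>
  The columns of the block \<open>m + 1\<close> of \<open>P\<^sub>n\<^sub>+\<^sub>1\<close>, preceded by the vector from which they arise by repeated
  application of the inverse of \<open>D\<^sub>n\<^sub>+\<^sub>1 + N\<close>.
\<close>

definition chain :: "nat \<Rightarrow> nat \<Rightarrow> nat \<Rightarrow> nat \<Rightarrow> 'c" where
  "chain n m t i = (case t of 0 \<Rightarrow> coupled_col n (Suc m) i | Suc t' \<Rightarrow> P (Suc n) $$ (i, blk_end r s m + t'))"

text \<open>Column \<open>blk_end r s m + t\<close> is \<open>chain\<close> at \<open>Suc t\<close>.
  For \<open>t = 0\<close> the source is the column of \<open>P_n E^(n)\<close>; for larger
  \<open>t\<close> the column of \<open>E\<close> vanishes and the previous column of the block
  takes over.\<close>

lemma chain_step: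
  assumes "Suc m \<le> r" "t < blk_dim r s (Suc m)" "i < G_dim r s"
  shows "D (Suc n) * chain n m (Suc t) i + (if is_end (Suc i) then 0 else chain n m (Suc t) (Suc i)) =
    chain n m t i"
proof -
  let ?j = "blk_end r s m + t"
  have j: "?j < G_dim r s"
    using assms blk_end_le_dim[of "Suc m"] by (simp add: blk_end_Suc)
  show ?thesis
  proof (cases t)
    case 0
    have "(\<Sum>k<G_dim r s. P n $$ (i, k) * (G_E r s u $$ (k, ?j)) ^ (CARD('f) ^ n)) =
      (\<Sum>k<G_dim r s. P n $$ (i, k) * (\<Sum>l=1..Suc m. if k + 1 = blk_end r s l
         then coupling l (Suc m) ^ (CARD('f) ^ n) else 0))"
      using 0 assms by (intro sum.cong[OF refl]) (simp only: G_E_start frob_sum frob_if add_0_right lessThan_iff)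
    also have "\<dots> = coupled_col n (Suc m) i"
      unfolding coupled_col_def last_col_def by (rule sum_blk_ends) (use assms in auto)
    finally have sum: "(\<Sum>k<G_dim r s. P n $$ (i, k) * (G_E r s u $$ (k, ?j)) ^ (CARD('f) ^ n)) = coupled_col n (Suc m) i" .
    have "is_end ?j" using 0 assms(1) by simp
    thus ?thesis
      using P_entry_eq[OF assms(3) j, of n] 0 unfolding sum by (simp add: chain_def cong: if_cong)
  next
    case (Suc t')
    have "\<not> is_end ?j" using assms Suc by (intro not_is_end_inner) auto
    thus ?thesis
      using P_entry_eq[OF assms(3) j, of n] Suc j by (simp add: chain_def G_E_inner cong: if_cong)
  qed
qed

lemma chain_last:
  assumes "Suc m \<le> r"
  shows "chain n m (blk_dim r s (Suc m)) i = last_col (Suc n) (Suc m) i"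
proof -
  obtain t where "blk_dim r s (Suc m) = Suc t"
    using blk_dim_pos[of "Suc m"] assms by (cases "blk_dim r s (Suc m)") auto
  thus ?thesis by (simp add: chain_def last_col_def blk_end_Suc)
qed

lemma last_col_0:
  assumes "m \<in> {1..r}" "i < G_dim r s"
  shows "last_col 0 m i = (if Suc i = blk_end r s m then 1 else 0)"
  using assms blk_end_le_dim[of m] blk_end_pos[of m] by (auto simp: last_col_def P_0)

text \<open>A row that closes a block receives nothing from \<open>N\<close>, so inverting
  \<open>D + N\<close> there is division by \<open>D\<close>.\<close>

lemma last_col_Suc_end:
  assumes "Suc m \<le> r" "i < G_dim r s" "is_end (Suc i)"
  shows "last_col (Suc n) (Suc m) i = coupled_col n (Suc m) i / D (Suc n) ^ blk_dim r s (Suc m)"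
proof -
  have "t \<le> blk_dim r s (Suc m) \<Longrightarrow> chain n m t i = coupled_col n (Suc m) i / D (Suc n) ^ t" for t
  proof (induction t)
    case 0
    thus ?case by (simp add: chain_def)
  next
    case (Suc t)
    thus ?case
      using chain_step[of m t i n] assms theta_diff_nonzero[of "Suc n"] by (simp add: field_simps)
  qed
  thus ?thesis using chain_last[OF assms(1), of n i] by simp
qed

section \<open>Uniform bounds in all rows\<close>

lemma absv_D_ge_1: "absv (D (Suc n)) \<ge> 1"
  using card_ge_2 by (subst absv_theta_diff) (auto intro!: one_le_power)

lemma absv_L_Suc: "absv (L \<iota> (Suc n)) = absv (L \<iota> n) * absv (D (Suc n))"
  by (simp only: L_Suc dist_mult_0)

text \<open>The divisions by \<open>D (Suc n)\<close>, one for each column of the block, cancel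
  against the growth from \<open>L_n\<close> to \<open>L_(n+1)\<close>, so the same \<open>K\<close>
  serves for n and n + 1.\<close>

lemma last_col_bound:
  assumes m: "Suc m \<le> r" and K: "K \<ge> 0"
    and coupled_col: "\<And>i. i < G_dim r s \<Longrightarrow> absv (coupled_col n (Suc m) i) * absv (L \<iota> n) ^ blk_dim r s (Suc m) \<le> K"
    and i: "i < G_dim r s"
  shows "absv (last_col (Suc n) (Suc m) i) * absv (L \<iota> (Suc n)) ^ blk_dim r s (Suc m) \<le> K"
proof -
  let ?b = "blk_dim r s (Suc m)"
 have "absv (D (Suc n)) > 0" using absv_D_ge_1[of n] by linarith
  hence pos: "absv (L \<iota> n) ^ ?b > 0" "absv (D (Suc n)) ^ ?b > 0"
    using L_nonzero[of n] by (simp_all only: zero_less_power zero_less_dist_iff not_False_eq_True)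
  have "absv (chain n m ?b i) \<le> K / absv (L \<iota> n) ^ ?b / absv (D (Suc n)) ^ ?b"
  proof (rule shift_chain_bound[where Z = is_end and T = ?b and d = "G_dim r s"])
    fix i assume "i < G_dim r s"
    thus "absv (chain n m 0 i) \<le> K / absv (L \<iota> n) ^ ?b"
      using coupled_col pos by (simp add: chain_def field_simps)
  qed (use chain_step m K i absv_D_ge_1 in auto)
  thus ?thesis
    using pos by (simp add: chain_last[OF m] absv_L_Suc power_mult_distrib field_simps del: power_Suc)
qed

text \<open>Outer induction on the block, inner on n. Constants combine by maximum in an ultrametric
  sum, so they do not accumulate along n.\<close>

lemma coupled_col_bounded:
  assumes u: "\<And>i. i \<in> {1..<r} \<Longrightarrow> absv (u i) \<le> radius (s i)" and "m \<le> r"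
  shows "\<exists>K\<ge>0. \<forall>n. \<forall>i<G_dim r s. absv (coupled_col n m i) * absv (L \<iota> n) ^ blk_dim r s m \<le> K"
  using assms(2)
proof (induction m)
  case 0
  thus ?case by auto
next
  case (Suc m)
  then obtain K where K: "K \<ge> 0"
    "\<And>n i. i < G_dim r s \<Longrightarrow> absv (coupled_col n m i) * absv (L \<iota> n) ^ blk_dim r s m \<le> K" by auto
  \<comment> \<open>1 covers the entries of \<open>P 0\<close>; \<open>radius (s m) * K\<close>
    covers the contribution of the previous block.\<close>
  define K' where "K' = max 1 (radius (s m) * K)"
  let ?b = "blk_dim r s (Suc m)"
  have uw: "absv (u m ^ (CARD('f) ^ n) * coupled_col n m i) * absv (L \<iota> n) ^ ?b \<le> K'" if "i < G_dim r s" for n i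
  proof (cases "m = 0")
    case True
    thus ?thesis by (simp add: K'_def)
  next
    case False
    have "absv (u m ^ (CARD('f) ^ n) * coupled_col n m i) * absv (L \<iota> n) ^ ?b =
      absv (L_quot (s m) (u m) n) * (absv (coupled_col n m i) * absv (L \<iota> n) ^ blk_dim r s m)"
      using blk_dim_Suc[of m r s] Suc.prems L_nonzero[of n]
      by (simp add: L_quot_def dist_mult_0 absv_divide absv_power power_add)
    also have "\<dots> \<le> radius (s m) * K"
      using K that False Suc.prems u[of m] radius_pos[of "s m"]
      by (intro mult_mono absv_L_quot_le) auto
    finally show ?thesis by (simp add: K'_def)
  qed
  have step: "absv (coupled_col n (Suc m) i) * absv (L \<iota> n) ^ ?b \<le> K'"
    if "i < G_dim r s" "absv (last_col n (Suc m) i) * absv (L \<iota> n) ^ ?b \<le> K'" for n i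
  proof -
    have "absv (coupled_col n (Suc m) i) \<le> max (absv (last_col n (Suc m) i)) (absv (u m ^ (CARD('f) ^ n) * coupled_col n m i))"
      unfolding coupled_col_Suc by (rule absv_diff_le)
    hence "absv (coupled_col n (Suc m) i) * absv (L \<iota> n) ^ ?b \<le>
      max (absv (last_col n (Suc m) i)) (absv (u m ^ (CARD('f) ^ n) * coupled_col n m i)) * absv (L \<iota> n) ^ ?b"
      by (rule mult_right_mono) simp
    also have "\<dots> \<le> K'" using that(2) uw[OF that(1), of n] by (simp add: max_def)
    finally show ?thesis .
  qed
  have "absv (coupled_col n (Suc m) i) * absv (L \<iota> n) ^ ?b \<le> K'" if "i < G_dim r s" for n i
    using that
  proof (induction n arbitrary: i)
    case 0
    thus ?case using Suc.prems by (intro step) (simp_all add: last_col_0 K'_def le_max_iff_disj)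
  next
    case (Suc n)
    have "absv (last_col (Suc n) (Suc m) i) * absv (L \<iota> (Suc n)) ^ ?b \<le> K'"
      using Suc.IH Suc.prems \<open>Suc m \<le> r\<close> by (intro last_col_bound) (auto simp: K'_def)
    with Suc.prems show ?case by (rule step)
  qed
  thus ?case by (intro exI[of _ K']) (simp add: K'_def)
qed

section \<open>Exact values in the last rows of the blocks\<close>

lemma coupled_col_end_sum:
  assumes "Suc m \<le> r" "i < G_dim r s" "is_end (Suc i)"
  shows "coupled_col n (Suc m) i * L \<iota> n ^ blk_dim r s (Suc m) = (if Suc i = blk_end r s (Suc m) then 1 else 0) -
    (\<Sum>k\<le>n. u m ^ (CARD('f) ^ k) * coupled_col k m i * L \<iota> k ^ blk_dim r s (Suc m))"
proof (induction n)
  case 0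
  show ?case using assms by (simp add: coupled_col_Suc last_col_0)
next
  case (Suc n)
  \<comment> \<open>The weight absorbs the division by \<open>D (Suc n)\<close>: passing from n to n
    + 1 only subtracts the new term of the sum.\<close>
  have "last_col (Suc n) (Suc m) i * L \<iota> (Suc n) ^ blk_dim r s (Suc m) =
      coupled_col n (Suc m) i * L \<iota> n ^ blk_dim r s (Suc m)"
    using theta_diff_nonzero[of "Suc n"]
    by (simp add: last_col_Suc_end[OF assms] L_Suc power_mult_distrib del: power_Suc)
  thus ?case using Suc by (simp add: coupled_col_Suc[of "Suc n"] algebra_simps del: power_Suc)
qed

text \<open>The constant 1 in the sum formula appears only for the block that the row closes, so
  nothing starts the recursion earlier. This is the block upper triangular shape of
  \<open>P_n\<close>, seen in the last rows.\<close>

lemma coupled_col_before_block: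
  assumes "l \<le> r" "m < l"
  shows "coupled_col n m (blk_end r s l - 1) = 0"
  using assms(2)
proof (induction m arbitrary: n)
  case (Suc m)
  let ?i = "blk_end r s l - 1"
  have l: "Suc ?i = blk_end r s l" "?i < G_dim r s"
    using blk_end_pos[of l] blk_end_le_dim[of l] assms Suc.prems by auto
  have "coupled_col n (Suc m) ?i * L \<iota> n ^ blk_dim r s (Suc m) = 0"
    using Suc assms l by (subst coupled_col_end_sum) (auto simp: blk_end_eq_iff)
  thus ?case using L_nonzero[of n] by simp
qed simp

text \<open>In the row closing block l the unit entry of \<open>P 0\<close> starts the recursion
  with the empty polylogarithm; each further block prepends \<open>s m\<close> and
  \<open>u m\<close> and contributes a sign, whence the reversed lists.\<close>

lemma coupled_col_Li_star:
  assumes l: "1 \<le> l" "l \<le> m" and m: "m \<le> r"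
  shows "coupled_col n m (blk_end r s l - 1) * L \<iota> n ^ blk_dim r s m =
    (- 1) ^ (m - l) * Li_star_upto (rev (map s [l..<m])) (rev (map u [l..<m])) n"
  using l(2) m
proof (induction m arbitrary: n rule: dec_induct)
  case base
  obtain k where k: "l = Suc k" using l by (cases l) auto
  let ?i = "blk_end r s l - 1"
  have i: "Suc ?i = blk_end r s l" "?i < G_dim r s"
    using blk_end_pos[of l] blk_end_le_dim[of l] l base by auto
  thus ?case
    using coupled_col_end_sum[of k ?i n] coupled_col_before_block[of l k] base k by simp
next
  case (step m)
  let ?i = "blk_end r s l - 1"
  let ?b = "blk_dim r s (Suc m)"
  let ?T = "Li_star_upto (rev (map s [l..<m])) (rev (map u [l..<m]))"
  have i: "Suc ?i = blk_end r s l" "?i < G_dim r s"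
    using blk_end_pos[of l] blk_end_le_dim[of l] l step by auto
  have "u m ^ (CARD('f) ^ k) * coupled_col k m ?i * L \<iota> k ^ ?b = (- 1) ^ (m - l) * (L_quot (s m) (u m) k * ?T k)" for k
  proof -
    have "u m ^ (CARD('f) ^ k) * coupled_col k m ?i * L \<iota> k ^ ?b =
      L_quot (s m) (u m) k * (coupled_col k m ?i * L \<iota> k ^ blk_dim r s m)"
      using blk_dim_Suc[of m r s] step.prems L_nonzero[of k] by (simp add: L_quot_def power_add)
    also have "coupled_col k m ?i * L \<iota> k ^ blk_dim r s m = (- 1) ^ (m - l) * ?T k"
      using step by simp
    finally show ?thesis by (simp add: mult_ac)
  qed
  hence "coupled_col n (Suc m) ?i * L \<iota> n ^ ?b = - (\<Sum>k\<le>n. (- 1) ^ (m - l) * (L_quot (s m) (u m) k * ?T k))"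
    using i step by (subst coupled_col_end_sum) (auto simp: blk_end_eq_iff)
  also have "\<dots> = (- 1) ^ (Suc m - l) * Li_star_upto (s m # rev (map s [l..<m])) (u m # rev (map u [l..<m])) n"
    using step by (simp add: Li_star_upto_Cons Suc_diff_le flip: sum_distrib_left)
  finally show ?case using step by simp
qed

section \<open>The logarithm series at \<open>v\<close>\<close>

abbreviation log_term :: "nat \<Rightarrow> 'c vec" where
  "log_term \<equiv> tmod_log_term \<iota> (G_dim r s) (G_rho_t \<iota> r s u) (G_v r s u)"

lemma log_term_eq:
  assumes "i < G_dim r s"
  shows "log_term n $ i = coupled_col n r i * u r ^ (CARD('f) ^ n)"
proof -
  have v: "G_v r s u $ k = (\<Sum>l=1..r. if k + 1 = blk_end r s l then coupling l r * u r else 0)"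
    if "k < G_dim r s" for k
  proof -
    have "(\<Prod>e=l..r. u e) = (\<Prod>e=l..<r. u e) * u r" if "l \<le> r" for l
      using that by (simp add: atLeastLessThanSuc_atLeastAtMost[symmetric])
    thus ?thesis using that unfolding G_v_def coupling_def
      by (simp add: mult.assoc cong: if_cong)
  qed
  have "log_term n $ i = (\<Sum>k<G_dim r s. P n $$ (i, k) * (G_v r s u $ k) ^ (CARD('f) ^ n))"
    using assms tw_carrierD(2,3)[OF P_carrier]
    by (auto simp: tmod_log_term_def G_v_def scalar_prod_def lessThan_atLeast0)
  also have "\<dots> = (\<Sum>k<G_dim r s. P n $$ (i, k) * (\<Sum>l=1..r. if k + 1 = blk_end r s l
      then (coupling l r * u r) ^ (CARD('f) ^ n) else 0))"
    by (intro sum.cong[OF refl]) (simp only: v frob_sum frob_if lessThan_iff)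
  also have "\<dots> = (\<Sum>l=1..r. last_col n l i * (coupling l r * u r) ^ (CARD('f) ^ n))"
    unfolding last_col_def by (rule sum_blk_ends) simp
  also have "\<dots> = coupled_col n r i * u r ^ (CARD('f) ^ n)"
    by (simp add: coupled_col_def sum_distrib_right power_mult_distrib mult.assoc)
  finally show ?thesis .
qed

text \<open>The last block has size \<open>s r\<close>, so its weight is the denominator of
  \<open>L_quot (s r) (u r) n\<close>, and each term is a bounded factor times a null
  sequence.\<close>

lemma log_term_summable:
  assumes "\<And>i. i \<in> {1..<r} \<Longrightarrow> absv (u i) \<le> radius (s i)" "absv (u r) < radius (s r)"
    and i: "i < G_dim r s"
  shows "summable (\<lambda>n. log_term n $ i)"
proof (rule nonarch_summable)
  obtain K where K: "\<And>n. absv (coupled_col n r i) * absv (L \<iota> n) ^ s r \<le> K"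
    using coupled_col_bounded[OF assms(1), of r] i by (auto simp: blk_dim_last)
  have "absv (log_term n $ i) \<le> K * absv (L_quot (s r) (u r) n)" for n
  proof -
    have "absv (log_term n $ i) = absv (coupled_col n r i) * absv (L \<iota> n) ^ s r * absv (L_quot (s r) (u r) n)"
      using i L_nonzero[of n] by (simp add: log_term_eq L_quot_def dist_mult_0 absv_divide absv_power)
    also have "\<dots> \<le> K * absv (L_quot (s r) (u r) n)"
      by (rule mult_right_mono[OF K]) simp
    finally show ?thesis .
  qed
  thus "(\<lambda>n. absv (log_term n $ i)) \<longlonglongrightarrow> 0"
    by (intro tendsto_sandwich[OF _ _ tendsto_const tendsto_mult_right_zero[where c = K, OF L_quot_tendsto_0[OF assms(2)]]])
      auto
qed

text \<open>Stopping the series at \<open>M\<close> amounts to stopping the polylogarithm at leading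
  index \<open>M\<close>.\<close>

lemma log_term_sum:
  assumes l: "1 \<le> l" "l \<le> r"
  shows "(\<Sum>n\<le>M. log_term n $ (blk_end r s l - 1)) =
    (- 1) ^ (r - l) * Li_star_upto (rev (map s [l..<Suc r])) (rev (map u [l..<Suc r])) M"
proof -
  let ?i = "blk_end r s l - 1"
  let ?T = "Li_star_upto (rev (map s [l..<r])) (rev (map u [l..<r]))"
  have i: "?i < G_dim r s" using blk_end_pos[of l] blk_end_le_dim[of l] l by auto
  have "log_term n $ ?i = (- 1) ^ (r - l) * (L_quot (s r) (u r) n * ?T n)" for n
  proof -
    have "log_term n $ ?i = L_quot (s r) (u r) n * (coupled_col n r ?i * L \<iota> n ^ blk_dim r s r)"
      using i L_nonzero[of n] by (simp add: log_term_eq L_quot_def blk_dim_last)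
    thus ?thesis using coupled_col_Li_star[OF l order_refl, of n] by simp
  qed
  thus ?thesis using l by (simp add: Li_star_upto_Cons sum_distrib_left)
qed

text \<open>Convergence of the series yields the limit of the truncations, which
  \<open>Li_star_has_sum\<close> turns into an unordered sum.\<close>

lemma tmod_log_at_blk_end:
  assumes u: "\<And>i. i \<in> {1..<r} \<Longrightarrow> absv (u i) \<le> radius (s i)" "absv (u r) < radius (s r)"
    and l: "1 \<le> l" "l \<le> r"
  shows "Li_star_converges \<iota> (rev (map s [l..<Suc r])) (rev (map u [l..<Suc r]))"
    and "tmod_log_at \<iota> (G_dim r s) (G_rho_t \<iota> r s u) (G_v r s u) $ (blk_end r s l - 1) =
       (- 1) ^ (r - l) * Li_star \<iota> (rev (map s [l..<Suc r])) (rev (map u [l..<Suc r]))"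
proof -
  let ?i = "blk_end r s l - 1"
  let ?ts = "rev (map s [l..<r])" and ?zs = "rev (map u [l..<r])"
  have i: "?i < G_dim r s" using blk_end_pos[of l] blk_end_le_dim[of l] l by auto
  have lists: "rev (map s [l..<Suc r]) = s r # ?ts" "rev (map u [l..<Suc r]) = u r # ?zs"
    using l by simp_all
  define S where "S = (\<Sum>n. log_term n $ ?i)"
  have sign: "(- 1) ^ (r - l) * ((- 1) ^ (r - l) * x) = x" for x :: 'c
    by (simp flip: mult.assoc power_add mult_2)
  have "(\<lambda>n. log_term n $ ?i) sums S"
    using log_term_summable[OF u i] by (simp add: S_def summable_sums)
  hence sums: "(\<lambda>M. \<Sum>n\<le>M. log_term n $ ?i) \<longlonglongrightarrow> S" by (simp add: sums_def_le)
  \<comment> \<open>Multiplication by a sign is an isometry, so the limit passes through it.\<close>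
  have "(\<lambda>M. (- 1) ^ (r - l) * (\<Sum>n\<le>M. log_term n $ ?i)) \<longlonglongrightarrow> (- 1) ^ (r - l) * S"
  proof (rule tendstoI)
    fix e :: real assume "e > 0"
    have "dist ((- 1) ^ (r - l) * x) ((- 1) ^ (r - l) * S) = dist x S" for x
    proof -
      have "dist ((- 1) ^ (r - l) * x) ((- 1) ^ (r - l) * S) = absv ((- 1) ^ (r - l) * (x - S))"
        by (subst dist_eq_dist_diff_0) (simp add: right_diff_distrib)
      also have "\<dots> = absv (x - S)" by (simp add: dist_mult_0 absv_power)
      finally show ?thesis by (simp add: dist_eq_dist_diff_0[of x S])
    qed
    thus "eventually (\<lambda>M. dist ((- 1) ^ (r - l) * (\<Sum>n\<le>M. log_term n $ ?i)) ((- 1) ^ (r - l) * S) < e) sequentially"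
      using tendstoD[OF sums \<open>e > 0\<close>] by simp
  qed
  hence "Li_star_upto (s r # ?ts) (u r # ?zs) \<longlonglongrightarrow> (- 1) ^ (r - l) * S"
    by (simp only: log_term_sum[OF l] lists sign)
  hence has_sum: "(Li_star_term \<iota> (s r # ?ts) (u r # ?zs) has_sum (- 1) ^ (r - l) * S)
      (Li_star_indices (length (s r # ?ts)))"
    using u l by (intro Li_star_has_sum) (auto simp: rev_nth)
  thus "Li_star_converges \<iota> (rev (map s [l..<Suc r])) (rev (map u [l..<Suc r]))"
    unfolding Li_star_converges_def lists by (rule has_sum_imp_summable)
  have "Li_star \<iota> (rev (map s [l..<Suc r])) (rev (map u [l..<Suc r])) = (- 1) ^ (r - l) * S"
    unfolding Li_star_def lists by (rule infsumI[OF has_sum])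
  thus "tmod_log_at \<iota> (G_dim r s) (G_rho_t \<iota> r s u) (G_v r s u) $ ?i =
       (- 1) ^ (r - l) * Li_star \<iota> (rev (map s [l..<Suc r])) (rev (map u [l..<Suc r]))"
    using i by (simp add: tmod_log_at_def S_def sign)
qed

end

theorem theorem4p2p3:
  fixes \<iota> :: "'f::{finite,Fields.field} fls alg_closure \<Rightarrow> 'c::{nonarch_field,complete_space}"
    and r :: nat and s :: "nat \<Rightarrow> nat" and u :: "nat \<Rightarrow> 'c"
  defines "q \<equiv> real CARD('f)"
    and "d \<equiv> G_dim r s"
    and "R \<equiv> G_rho_t \<iota> r s u"
    and "v \<equiv> G_v r s u"
  assumes "C_infinity \<iota>"
    and "r \<ge> 1"
    and "\<And>i. i \<in> {1..r} \<Longrightarrow> s i \<ge> 1"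
    and "\<And>i. i \<in> {1..r} \<Longrightarrow> u i \<in> k_bar \<iota> \<and> u i \<noteq> 0"
    and "absv (u r) < q powr (real (s r) * q / (q - 1))"
    and "\<And>i. i \<in> {1..<r} \<Longrightarrow> absv (u i) \<le> q powr (real (s i) * q / (q - 1))"
  shows "tmod_log_converges \<iota> d R v \<and>
    (\<forall>l\<in>{1..r}.
       Li_star_converges \<iota> (rev (map s [l..<Suc r])) (rev (map u [l..<Suc r])) \<and>
       tmod_log_at \<iota> d R v $ (blk_end r s l - 1) =
         (- 1) ^ (r - l) * Li_star \<iota> (rev (map s [l..<Suc r])) (rev (map u [l..<Suc r]))) \<and>
    tmod_log_at \<iota> d R v $ ((\<Sum>i=1..r. s i) - 1) =
      (- 1) ^ (r - 1) * Li_star \<iota> (rev (map s [1..<Suc r])) (rev (map u [1..<Suc r]))"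
proof -
  interpret star_module \<iota> r s u
    by standard (use assms in auto)
  have u: "\<And>i. i \<in> {1..<r} \<Longrightarrow> absv (u i) \<le> radius (s i)" "absv (u r) < radius (s r)"
    using assms by (simp_all add: radius_def)
  have conv: "tmod_log_converges \<iota> d R v"
    unfolding tmod_log_converges_def d_def R_def v_def
    using log_term_summable[OF u] by blast
  \<comment> \<open>The first block has size \<open>s_1 + ... + s_r\<close>, so the last claim is
    the case \<open>l = 1\<close>.\<close>
  have "blk_end r s 1 = (\<Sum>i=1..r. s i)"
    by (simp add: blk_end_def blk_dim_def)
  with tmod_log_at_blk_end[OF u] conv \<open>r \<ge> 1\<close> show ?thesis
    unfolding d_def R_def v_def by (metis atLeastAtMost_iff order_refl)
qed

end
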